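(* Any quasi-Brownian isometry has an entrywise extension to a Brownian isometry. That is, for every quasi-Brownian isometry $T\in B(\mathcal H)$ there exist an orthogonal decomposition $\mathcal H=\mathcal H_1\oplus\mathcal H_2$ (which, if $T$ is not an isometry, is one with respect to which $T$ is a Brownian-type operator of class $\mathscr I$), Hilbert spaces $\mathcal K_1\supseteq\mathcal H_1$ and $\mathcal K_2\supseteq\mathcal H_2$, and a Brownian isometry $R\in B(\mathcal K_1\oplus\mathcal K_2)$ such that $T\preceq R$ with respect to these decompositions.
   Context: All Hilbert spaces are complex; $B(\mathcal H)$ is the algebra of bounded linear operators on $\mathcal H$. $T\in B(\mathcal H)$ is a $2$-isometry if $T^{*2}T^2-2T^*T+I=0$; then $\triangle_T:=T^*T-I\ge 0$. A $2$-isometry $T$ is a Brownian isometry if $\triangle_T\triangle_{T^*}\triangle_T=0$ (where $\triangle_{T^*}=TT^*-I$), and a quasi-Brownian isometry if $\triangle_TT=\triangle_T^{1/2}T\triangle_T^{1/2}$. $T$ is a Brownian-type operator of class $\mathscr I$ with respect to $\mathcal H=\mathcal H_1\oplus\mathcal H_2$ (with $\mathcal H_1,\mathcal H_2$ nonzero) if $T=\begin{bmatrix}V&E\\0&X\end{bmatrix}$ with $V$ and $X$ isometries, $V^*E=0$ and $XE^*E=E^*EX$. Entrywise extension: $\begin{bmatrix}A_{11}&A_{12}\\ A_{21}&A_{22}\end{bmatrix}\preceq\begin{bmatrix}\tilde A_{11}&\tilde A_{12}\\ \tilde A_{21}&\tilde A_{22}\end{bmatrix}$, for operators on $\mathcal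 H_1\oplus\mathcal H_2$ and $\mathcal K_1\oplus\mathcal K_2$ respectively, means $\mathcal H_j\subseteq\mathcal K_j$ (isometric embedding) and $A_{ij}h_j=\tilde A_{ij}h_j$ for all $h_j\in\mathcal H_j$ and $i,j\in\{1,2\}$. *)

theory Defs
  imports "HOL-Analysis.Analysis"
begin

section \<open>Complex Hilbert spaces\<close>

text \<open>
  The inner product is linear in the first argument. The underlying real inner product,
  which supplies norm and topology, is the real part of the complex one.
\<close>

class complex_inner = real_inner +
  fixes scaleC :: "complex \<Rightarrow> 'a \<Rightarrow> 'a" (infixr "*\<^sub>C" 75)
    and cinner :: "'a \<Rightarrow> 'a \<Rightarrow> complex"
  assumes scaleC_add_right: "a *\<^sub>C (x + y) = a *\<^sub>C x + a *\<^sub>C y"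
    and scaleC_add_left: "(a + b) *\<^sub>C x = a *\<^sub>C x + b *\<^sub>C x"
    and scaleC_scaleC: "a *\<^sub>C (b *\<^sub>C x) = (a * b) *\<^sub>C x"
    and scaleC_of_real: "complex_of_real r *\<^sub>C x = r *\<^sub>R x"
    and cinner_commute: "cinner x y = cnj (cinner y x)"
    and cinner_add_left: "cinner (x + y) z = cinner x z + cinner y z"
    and cinner_scaleC_left: "cinner (a *\<^sub>C x) y = a * cinner x y"
    and inner_eq_Re_cinner: "inner x y = Re (cinner x y)"

class chilbert_space = complex_inner + complete_space
begin
subclass banach ..
end


section \<open>Bounded operators, adjoints and positive square roots\<close>

definition bounded_clinear :: "('a::complex_inner \<Rightarrow> 'b::complex_inner) \<Rightarrow> bool" where
  "bounded_clinear f \<longleftrightarrow> bounded_linear f \<and> (\<forall>c x. f (c *\<^sub>C x) = c *\<^sub>C f x)"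

definition closed_csubspace :: "'a::complex_inner set \<Rightarrow> bool" where
  "closed_csubspace M \<longleftrightarrow> closed M \<and> subspace M \<and> (\<forall>c. \<forall>x\<in>M. c *\<^sub>C x \<in> M)"

text \<open>
  \<open>adj_on M f\<close> is the adjoint of an operator \<open>f\<close> from the closed subspace \<open>M\<close> to a
  closed subspace \<open>N\<close>. Its values at points of \<open>N\<close> do not depend on the codomain, so \<open>N\<close>
  is not an argument.
\<close>

definition adj_on :: "'a::complex_inner set \<Rightarrow> ('a \<Rightarrow> 'b::complex_inner) \<Rightarrow> 'b \<Rightarrow> 'a" where
  "adj_on M f y = (THE z. z \<in> M \<and> (\<forall>x\<in>M. cinner (f x) y = cinner x z))"

abbreviation adj :: "('a::complex_inner \<Rightarrow> 'b::complex_inner) \<Rightarrow> 'b \<Rightarrow> 'a" where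
  "adj \<equiv> adj_on UNIV"

definition positive_op :: "('a::complex_inner \<Rightarrow> 'a) \<Rightarrow> bool" where
  "positive_op A \<longleftrightarrow> bounded_clinear A \<and> (\<forall>x. cinner (A x) x \<in> \<real>\<^sub>\<ge>\<^sub>0)"

definition op_sqrt :: "('a::complex_inner \<Rightarrow> 'a) \<Rightarrow> 'a \<Rightarrow> 'a" where
  "op_sqrt A = (THE S. positive_op S \<and> S \<circ> S = A)"

definition isometry_on :: "'a::complex_inner set \<Rightarrow> ('a \<Rightarrow> 'b::complex_inner) \<Rightarrow> bool" where
  "isometry_on M f \<longleftrightarrow> (\<forall>x\<in>M. norm (f x) = norm x)"


section \<open>Classes of 2-isometries\<close>

definition two_isometry :: "('a::complex_inner \<Rightarrow> 'a) \<Rightarrow> bool" where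
  "two_isometry T \<longleftrightarrow> bounded_clinear T \<and>
     (\<forall>x. adj T (adj T (T (T x))) - 2 *\<^sub>R adj T (T x) + x = 0)"

definition defect :: "('a::complex_inner \<Rightarrow> 'a) \<Rightarrow> 'a \<Rightarrow> 'a" where
  "defect T x = adj T (T x) - x"

definition codefect :: "('a::complex_inner \<Rightarrow> 'a) \<Rightarrow> 'a \<Rightarrow> 'a" where
  "codefect T x = T (adj T x) - x"

definition brownian_isometry :: "('a::complex_inner \<Rightarrow> 'a) \<Rightarrow> bool" where
  "brownian_isometry T \<longleftrightarrow> two_isometry T \<and> (\<forall>x. defect T (codefect T (defect T x)) = 0)"

definition quasi_brownian_isometry :: "('a::complex_inner \<Rightarrow> 'a) \<Rightarrow> bool" where
  "quasi_brownian_isometry T \<longleftrightarrow> two_isometry T \<and>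
     defect T \<circ> T = op_sqrt (defect T) \<circ> T \<circ> op_sqrt (defect T)"


section \<open>Orthogonal decompositions and operator matrices\<close>

definition orth_decomp :: "'a::complex_inner set \<Rightarrow> 'a set \<Rightarrow> bool" where
  "orth_decomp M N \<longleftrightarrow> closed_csubspace M \<and> closed_csubspace N \<and>
     (\<forall>x\<in>M. \<forall>y\<in>N. cinner x y = 0) \<and> (\<forall>x. \<exists>y\<in>M. \<exists>z\<in>N. x = y + z)"

definition orth_proj :: "'a::complex_inner set \<Rightarrow> 'a \<Rightarrow> 'a" where
  "orth_proj M x = (THE y. y \<in> M \<and> (\<forall>z\<in>M. cinner (x - y) z = 0))"

text \<open>\<open>block M N A\<close> is the entry of \<open>A\<close> that maps \<open>N\<close> to \<open>M\<close>; its domain is \<open>N\<close>.\<close>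

definition block :: "'a::complex_inner set \<Rightarrow> 'a set \<Rightarrow> ('a \<Rightarrow> 'a) \<Rightarrow> 'a \<Rightarrow> 'a" where
  "block M N A = (\<lambda>h\<in>N. orth_proj M (A h))"

definition brownian_type_I :: "'a::complex_inner set \<Rightarrow> 'a set \<Rightarrow> ('a \<Rightarrow> 'a) \<Rightarrow> bool" where
  "brownian_type_I H\<^sub>1 H\<^sub>2 T \<longleftrightarrow>
     orth_decomp H\<^sub>1 H\<^sub>2 \<and> H\<^sub>1 \<noteq> {0} \<and> H\<^sub>2 \<noteq> {0} \<and> bounded_clinear T \<and>
     (let V = block H\<^sub>1 H\<^sub>1 T; E = block H\<^sub>1 H\<^sub>2 T; X = block H\<^sub>2 H\<^sub>2 T in
        (\<forall>h\<in>H\<^sub>1. block H\<^sub>2 H\<^sub>1 T h = 0) \<and>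
        isometry_on H\<^sub>1 V \<and> isometry_on H\<^sub>2 X \<and>
        (\<forall>h\<in>H\<^sub>2. adj_on H\<^sub>1 V (E h) = 0) \<and>
        (\<forall>h\<in>H\<^sub>2. X (adj_on H\<^sub>2 E (E h)) = adj_on H\<^sub>2 E (E (X h))))"

definition isometric_embedding ::
    "'a::complex_inner set \<Rightarrow> 'b::complex_inner set \<Rightarrow> ('a \<Rightarrow> 'b) \<Rightarrow> bool" where
  "isometric_embedding M N J \<longleftrightarrow> J ` M \<subseteq> N \<and>
     (\<forall>x\<in>M. \<forall>y\<in>M. J (x + y) = J x + J y) \<and> (\<forall>c. \<forall>x\<in>M. J (c *\<^sub>C x) = c *\<^sub>C J x) \<and>
     isometry_on M J"

definition entrywise_extension ::
    "'a::complex_inner set \<Rightarrow> 'a set \<Rightarrow> ('a \<Rightarrow> 'a) \<Rightarrow>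
     'b::complex_inner set \<Rightarrow> 'b set \<Rightarrow> ('b \<Rightarrow> 'b) \<Rightarrow> bool" where
  "entrywise_extension H\<^sub>1 H\<^sub>2 A K\<^sub>1 K\<^sub>2 B \<longleftrightarrow>
     (\<exists>J\<^sub>1 J\<^sub>2. isometric_embedding H\<^sub>1 K\<^sub>1 J\<^sub>1 \<and> isometric_embedding H\<^sub>2 K\<^sub>2 J\<^sub>2 \<and>
        (\<forall>h\<in>H\<^sub>1. J\<^sub>1 (block H\<^sub>1 H\<^sub>1 A h) = block K\<^sub>1 K\<^sub>1 B (J\<^sub>1 h)) \<and>
        (\<forall>h\<in>H\<^sub>2. J\<^sub>1 (block H\<^sub>1 H\<^sub>2 A h) = block K\<^sub>1 K\<^sub>2 B (J\<^sub>2 h)) \<and>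
        (\<forall>h\<in>H\<^sub>1. J\<^sub>2 (block H\<^sub>2 H\<^sub>1 A h) = block K\<^sub>2 K\<^sub>1 B (J\<^sub>1 h)) \<and>
        (\<forall>h\<in>H\<^sub>2. J\<^sub>2 (block H\<^sub>2 H\<^sub>2 A h) = block K\<^sub>2 K\<^sub>2 B (J\<^sub>2 h)))"


section \<open>Square-summable sequences\<close>

text \<open>
  HOL cannot quantify existentially over types. The Hilbert space of square-summable sequences
  in \<open>'a\<close> is large enough to serve as the extension space of an operator on \<open>'a\<close>; asking a
  decomposition to exhaust it loses nothing, since an identity summand can be added to a
  Brownian isometry.
\<close>

lemma cinner_norm_sq: "cinner x x = complex_of_real ((norm x)\<^sup>2)"
  for x :: "'a::complex_inner"
proof (rule complex_eqI)
  show "Re (cinner x x) = Re (complex_of_real ((norm x)\<^sup>2))"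
    by (simp add: inner_eq_Re_cinner[symmetric] power2_norm_eq_inner)
  have "Im (cinner x x) = Im (cnj (cinner x x))" using cinner_commute[of x x] by simp
  then show "Im (cinner x x) = Im (complex_of_real ((norm x)\<^sup>2))" by simp
qed

lemma norm_scaleC: "norm (a *\<^sub>C x) = cmod a * norm x" for x :: "'a::complex_inner"
proof -
  have "cinner (a *\<^sub>C x) (a *\<^sub>C x) = a * cnj (a * cinner x x)"
    by (metis cinner_commute cinner_scaleC_left)
  also have "\<dots> = complex_of_real ((cmod a * norm x)\<^sup>2)"
    by (simp add: cinner_norm_sq power_mult_distrib complex_norm_square mult.assoc
        flip: of_real_power)
  finally have "(norm (a *\<^sub>C x))\<^sup>2 = (cmod a * norm x)\<^sup>2"
    unfolding cinner_norm_sq of_real_eq_iff .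
  then show ?thesis by (simp add: power2_eq_iff_nonneg)
qed

lemma cmod_cinner_le: "cmod (cinner x y) \<le> norm x * norm y" for x y :: "'a::complex_inner"
proof -
  define a where "a = cnj (sgn (cinner x y))"
  have "a * cinner x y = complex_of_real (cmod (cinner x y))"
    unfolding a_def sgn_div_norm
    by (cases "cinner x y = 0")
      (simp_all add: scaleR_conv_of_real field_simps power2_eq_square flip: complex_norm_square)
  then have "cmod (cinner x y) = inner (a *\<^sub>C x) y"
    by (simp add: inner_eq_Re_cinner cinner_scaleC_left)
  also have "\<dots> \<le> norm (a *\<^sub>C x) * norm y" by (rule norm_cauchy_schwarz)
  also have "\<dots> \<le> norm x * norm y"
    by (simp add: norm_scaleC a_def norm_sgn mult_left_le_one_le mult_right_mono)
  finally show ?thesis .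
qed

typedef (overloaded) 'a ell2 = "{f :: nat \<Rightarrow> 'a::complex_inner. summable (\<lambda>n. (norm (f n))\<^sup>2)}"
  morphisms coord Abs_ell2
  by (rule exI[of _ "\<lambda>_. 0"]) simp

setup_lifting type_definition_ell2

lemma summable_coord: "summable (\<lambda>n. (norm (coord f n))\<^sup>2)"
  using coord[of f] by simp

lemma norm_add_sq_le: "(norm (x + y))\<^sup>2 \<le> 2 * (norm x)\<^sup>2 + 2 * (norm y)\<^sup>2"
  for x y :: "'a::real_normed_vector"
proof -
  have "(norm (x + y))\<^sup>2 \<le> (norm x + norm y)\<^sup>2"
    by (intro power_mono norm_triangle_ineq norm_ge_zero)
  moreover have "0 \<le> (norm x - norm y)\<^sup>2" by simp
  ultimately show ?thesis by (simp add: power2_sum power2_diff)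
qed

lemma summable_norm_add_sq:
  fixes f g :: "nat \<Rightarrow> 'a::real_normed_vector"
  assumes "summable (\<lambda>n. (norm (f n))\<^sup>2)" "summable (\<lambda>n. (norm (g n))\<^sup>2)"
  shows "summable (\<lambda>n. (norm (f n + g n))\<^sup>2)"
  by (rule summable_comparison_test'[where N = 0
        and g = "\<lambda>n. 2 * (norm (f n))\<^sup>2 + 2 * (norm (g n))\<^sup>2"])
    (auto intro!: summable_add summable_mult assms norm_add_sq_le)

lemma summable_cinner:
  "summable (\<lambda>n. cinner (coord f n) (coord g n))"
proof (rule summable_comparison_test'[where N = 0
      and g = "\<lambda>n. (norm (coord f n))\<^sup>2 + (norm (coord g n))\<^sup>2"])
  show "summable (\<lambda>n. (norm (coord f n))\<^sup>2 + (norm (coord g n))\<^sup>2)"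
    by (intro summable_add summable_coord)
  fix n
  have "norm (coord f n) * norm (coord g n) \<le> (norm (coord f n))\<^sup>2 + (norm (coord g n))\<^sup>2"
  proof -
    have "2 * (norm (coord f n) * norm (coord g n))
        \<le> (norm (coord f n))\<^sup>2 + (norm (coord g n))\<^sup>2"
      using sum_squares_bound[of "norm (coord f n)" "norm (coord g n)"] by simp
    moreover have "0 \<le> norm (coord f n) * norm (coord g n)" by simp
    ultimately show ?thesis by linarith
  qed
  then show "norm (cinner (coord f n) (coord g n))
      \<le> (norm (coord f n))\<^sup>2 + (norm (coord g n))\<^sup>2"
    using cmod_cinner_le[of "coord f n" "coord g n"] by linarith
qed

instantiation ell2 :: (complex_inner) complex_inner
begin

lift_definition zero_ell2 :: "'a ell2" is "\<lambda>_. 0" by simp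

lift_definition plus_ell2 :: "'a ell2 \<Rightarrow> 'a ell2 \<Rightarrow> 'a ell2" is "\<lambda>f g n. f n + g n"
  by (rule summable_norm_add_sq)

lift_definition uminus_ell2 :: "'a ell2 \<Rightarrow> 'a ell2" is "\<lambda>f n. - f n" by simp

lift_definition minus_ell2 :: "'a ell2 \<Rightarrow> 'a ell2 \<Rightarrow> 'a ell2" is "\<lambda>f g n. f n - g n"
proof -
  fix f g :: "nat \<Rightarrow> 'a"
  assume "summable (\<lambda>n. (norm (f n))\<^sup>2)" "summable (\<lambda>n. (norm (g n))\<^sup>2)"
  then show "summable (\<lambda>n. (norm (f n - g n))\<^sup>2)"
    using summable_norm_add_sq[of f "\<lambda>n. - g n"] by simp
qed

lift_definition scaleC_ell2 :: "complex \<Rightarrow> 'a ell2 \<Rightarrow> 'a ell2" is "\<lambda>a f n. a *\<^sub>C f n"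
  by (simp add: norm_scaleC power_mult_distrib summable_mult)

lift_definition scaleR_ell2 :: "real \<Rightarrow> 'a ell2 \<Rightarrow> 'a ell2" is "\<lambda>a f n. a *\<^sub>R f n"
  by (simp add: power_mult_distrib summable_mult)

definition cinner_ell2 :: "'a ell2 \<Rightarrow> 'a ell2 \<Rightarrow> complex" where
  "cinner_ell2 f g = (\<Sum>n. cinner (coord f n) (coord g n))"

definition inner_ell2 :: "'a ell2 \<Rightarrow> 'a ell2 \<Rightarrow> real" where
  "inner_ell2 f g = Re (cinner f g)"

definition norm_ell2 :: "'a ell2 \<Rightarrow> real" where
  "norm_ell2 f = sqrt (inner f f)"

definition sgn_ell2 :: "'a ell2 \<Rightarrow> 'a ell2" where
  "sgn_ell2 f = inverse (norm f) *\<^sub>R f"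

definition dist_ell2 :: "'a ell2 \<Rightarrow> 'a ell2 \<Rightarrow> real" where
  "dist_ell2 f g = norm (f - g)"

definition uniformity_ell2 :: "('a ell2 \<times> 'a ell2) filter" where
  "uniformity_ell2 = (INF e\<in>{0<..}. principal {(x, y). dist x y < e})"

definition open_ell2 :: "'a ell2 set \<Rightarrow> bool" where
  "open_ell2 U \<longleftrightarrow> (\<forall>x\<in>U. \<forall>\<^sub>F (x', y) in uniformity. x' = x \<longrightarrow> y \<in> U)"

instance
proof
  fix f g h :: "'a ell2" and r s :: real and a b :: complex
  show "f + g + h = f + (g + h)" "f + g = g + f" "0 + f = f" "- f + f = 0" "f - g = f + - g"
    by (transfer; simp add: fun_eq_iff algebra_simps)+
  show "r *\<^sub>R (f + g) = r *\<^sub>R f + r *\<^sub>R g" "(r + s) *\<^sub>R f = r *\<^sub>R f + s *\<^sub>R f"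
    "r *\<^sub>R s *\<^sub>R f = (r * s) *\<^sub>R f" "1 *\<^sub>R f = f"
    by (transfer; simp add: fun_eq_iff algebra_simps)+
  show "a *\<^sub>C (f + g) = a *\<^sub>C f + a *\<^sub>C g" "(a + b) *\<^sub>C f = a *\<^sub>C f + b *\<^sub>C f"
    "a *\<^sub>C b *\<^sub>C f = (a * b) *\<^sub>C f"
    by (transfer; simp add: fun_eq_iff scaleC_add_right scaleC_add_left scaleC_scaleC)+
  show sc: "complex_of_real r *\<^sub>C f = r *\<^sub>R f" for r and f :: "'a ell2"
    by (transfer; simp add: fun_eq_iff scaleC_of_real)
  show comm: "cinner f g = cnj (cinner g f)" for f g :: "'a ell2"
  proof -
    have "(\<lambda>n. cnj (cinner (coord g n) (coord f n))) sums cnj (cinner g f)"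
      unfolding cinner_ell2_def sums_cnj by (rule summable_sums[OF summable_cinner])
    then have "(\<lambda>n. cinner (coord f n) (coord g n)) sums cnj (cinner g f)"
      by (simp only: cinner_commute[symmetric])
    then show ?thesis unfolding cinner_ell2_def by (rule sums_unique[symmetric])
  qed
  show add: "cinner (f + g) h = cinner f h + cinner g h"
    unfolding cinner_ell2_def
    by (subst suminf_add[OF summable_cinner summable_cinner])
      (simp add: plus_ell2.rep_eq cinner_add_left)
  show mult: "cinner (a *\<^sub>C f) g = a * cinner f g" for a and f g :: "'a ell2"
    unfolding cinner_ell2_def
    by (subst suminf_mult[OF summable_cinner, symmetric])
      (simp add: scaleC_ell2.rep_eq cinner_scaleC_left)
  show "inner f g = Re (cinner f g)" by (simp add: inner_ell2_def)
  show "inner f g = inner g f"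
    unfolding inner_ell2_def by (subst comm) simp
  show "inner (f + g) h = inner f h + inner g h"
    by (simp add: inner_ell2_def add)
  show "inner (r *\<^sub>R f) g = r * inner f g"
    by (simp add: inner_ell2_def sc[symmetric] mult)
  have nn: "cinner f f = complex_of_real (\<Sum>n. (norm (coord f n))\<^sup>2)"
    unfolding cinner_ell2_def
    by (simp only: cinner_norm_sq suminf_of_real[OF summable_coord, symmetric])
  show "0 \<le> inner f f"
    by (simp add: inner_ell2_def nn suminf_nonneg[OF summable_coord])
  show "inner f f = 0 \<longleftrightarrow> f = 0"
  proof -
    have "inner f f = 0 \<longleftrightarrow> (\<forall>n. (norm (coord f n))\<^sup>2 = 0)"
      by (simp add: inner_ell2_def nn suminf_eq_zero_iff[OF summable_coord])
    also have "\<dots> \<longleftrightarrow> f = 0"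
      by (simp add: coord_inject[symmetric] zero_ell2.rep_eq fun_eq_iff)
    finally show ?thesis .
  qed
  show "norm f = sqrt (inner f f)" by (rule norm_ell2_def)
  show "sgn f = inverse (norm f) *\<^sub>R f" by (rule sgn_ell2_def)
  show "dist f g = norm (f - g)" by (rule dist_ell2_def)
next
  show "uniformity = (INF e\<in>{0<..}. principal {(x, y :: 'a ell2). dist x y < e})"
    by (rule uniformity_ell2_def)
next
  fix U :: "'a ell2 set"
  show "open U \<longleftrightarrow> (\<forall>x\<in>U. \<forall>\<^sub>F (x', y) in uniformity. x' = x \<longrightarrow> y \<in> U)"
    by (rule open_ell2_def)
qed

end

lemma norm_ell2_sq: "(norm f)\<^sup>2 = (\<Sum>n. (norm (coord f n))\<^sup>2)" for f :: "'a::complex_inner ell2"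
proof -
  have "complex_of_real ((norm f)\<^sup>2) = complex_of_real (\<Sum>n. (norm (coord f n))\<^sup>2)"
    unfolding cinner_norm_sq[symmetric] cinner_ell2_def
    by (simp only: cinner_norm_sq suminf_of_real[OF summable_coord, symmetric])
  then show ?thesis by (simp only: of_real_eq_iff)
qed

lemma sum_coord_le: "(\<Sum>n<N. (norm (coord f n))\<^sup>2) \<le> (norm f)\<^sup>2"
  unfolding norm_ell2_sq by (rule sum_le_suminf[OF summable_coord]) auto

lemma norm_coord_le: "norm (coord f n) \<le> norm f"
proof -
  have "(norm (coord f n))\<^sup>2 \<le> (\<Sum>k<Suc n. (norm (coord f k))\<^sup>2)"
    by (rule member_le_sum) auto
  then have "(norm (coord f n))\<^sup>2 \<le> (norm f)\<^sup>2" using sum_coord_le order_trans by blast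
  then show ?thesis by (rule power2_le_imp_le) simp
qed

instance ell2 :: (chilbert_space) chilbert_space
proof
  fix X :: "nat \<Rightarrow> 'a ell2"
  assume X: "Cauchy X"
  have "Cauchy (\<lambda>m. coord (X m) n)" for n
  proof (rule metric_CauchyI)
    fix e :: real assume "0 < e"
    from metric_CauchyD[OF X this] obtain M where
      M: "\<And>m k. m \<ge> M \<Longrightarrow> k \<ge> M \<Longrightarrow> dist (X m) (X k) < e" by blast
    have "dist (coord (X m) n) (coord (X k) n) \<le> dist (X m) (X k)" for m k
      using norm_coord_le[of "X m - X k" n] by (simp add: dist_norm minus_ell2.rep_eq)
    with M show "\<exists>M. \<forall>m\<ge>M. \<forall>k\<ge>M. dist (coord (X m) n) (coord (X k) n) < e"
      by (meson le_less_trans)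
  qed
  then have "\<exists>l. (\<lambda>m. coord (X m) n) \<longlonglongrightarrow> l" for n
    by (simp add: Cauchy_convergent_iff convergent_def)
  then obtain f where f: "\<And>n. (\<lambda>m. coord (X m) n) \<longlonglongrightarrow> f n" by metis
  have partial: "(\<Sum>n<N. (norm (coord (X m) n - f n))\<^sup>2) \<le> e\<^sup>2"
    if M: "\<And>k. k \<ge> M \<Longrightarrow> dist (X m) (X k) < e" for M m N e
  proof (rule LIMSEQ_le_const2)
    show "(\<lambda>k. \<Sum>n<N. (norm (coord (X m) n - coord (X k) n))\<^sup>2)
        \<longlonglongrightarrow> (\<Sum>n<N. (norm (coord (X m) n - f n))\<^sup>2)"
      by (intro tendsto_intros f)
    have "(\<Sum>n<N. (norm (coord (X m) n - coord (X k) n))\<^sup>2) \<le> e\<^sup>2" if "k \<ge> M" for k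
    proof -
      have "(\<Sum>n<N. (norm (coord (X m) n - coord (X k) n))\<^sup>2) \<le> (norm (X m - X k))\<^sup>2"
        using sum_coord_le[of "X m - X k" N] by (simp add: minus_ell2.rep_eq)
      also have "\<dots> \<le> e\<^sup>2"
        using M[OF that] by (intro power_mono) (auto simp: dist_norm)
      finally show ?thesis .
    qed
    then show "\<exists>K. \<forall>k\<ge>K. (\<Sum>n<N. (norm (coord (X m) n - coord (X k) n))\<^sup>2) \<le> e\<^sup>2" by blast
  qed
  have summ: "summable (\<lambda>n. (norm (coord (X m) n - f n))\<^sup>2)"
    if "\<And>k. k \<ge> M \<Longrightarrow> dist (X m) (X k) < e" for M m e
    by (rule summableI_nonneg_bounded[OF _ partial[OF that]]) auto
  obtain M0 where M0: "\<And>m k. m \<ge> M0 \<Longrightarrow> k \<ge> M0 \<Longrightarrow> dist (X m) (X k) < 1"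
    using metric_CauchyD[OF X zero_less_one] by blast
  have "summable (\<lambda>n. (norm (coord (X M0) n - f n))\<^sup>2)"
    by (rule summ[OF M0]) auto
  then have "summable (\<lambda>n. (norm (f n - coord (X M0) n))\<^sup>2)"
    by (simp add: norm_minus_commute)
  from summable_norm_add_sq[OF this summable_coord[of "X M0"]]
  have "summable (\<lambda>n. (norm (f n))\<^sup>2)" by simp
  then have F: "coord (Abs_ell2 f) = f" by (simp add: Abs_ell2_inverse)
  have "X \<longlonglongrightarrow> Abs_ell2 f"
  proof (rule metric_LIMSEQ_I)
    fix e :: real assume e: "0 < e"
    then obtain M where M: "\<And>m k. m \<ge> M \<Longrightarrow> k \<ge> M \<Longrightarrow> dist (X m) (X k) < e / 2"
      using metric_CauchyD[OF X, of "e / 2"] by auto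
    have "dist (X m) (Abs_ell2 f) < e" if m: "m \<ge> M" for m
    proof -
      have "(norm (X m - Abs_ell2 f))\<^sup>2 \<le> (e / 2)\<^sup>2"
        unfolding norm_ell2_sq minus_ell2.rep_eq F
        by (rule suminf_le_const[OF summ[OF M[OF m]] partial[OF M[OF m]]])
      then have "norm (X m - Abs_ell2 f) \<le> e / 2"
        using e by (auto intro: power2_le_imp_le)
      with e show ?thesis by (simp add: dist_norm)
    qed
    then show "\<exists>M. \<forall>m\<ge>M. dist (X m) (Abs_ell2 f) < e" by blast
  qed
  then show "convergent X" by (rule convergentI)
qed

end

theory Submission
  imports Defs
begin

text \<open>
  Let \<open>S\<close> be the square root of the defect operator of \<open>T\<close>, and decompose the space into the
  kernel of \<open>S\<close> and its orthogonal complement. With respect to it \<open>T\<close> is upper triangular with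
  isometric diagonal entries \<open>V\<close> and \<open>X\<close>, the upper right corner \<open>E\<close> satisfies
  \<open>V\<^sup>* E = 0\<close> and \<open>E\<^sup>* E = S\<^sup>2\<close>, and the quasi-Brownian identity makes \<open>X\<close> commute with \<open>S\<close>.
  An operator of this form is a Brownian isometry as soon as \<open>X\<close> is unitary. Let \<open>N\<close> be the
  orthogonal complement of the range of \<open>X\<close>; it reduces \<open>S\<close>. Then
  \<open>(h, n\<^sub>1, n\<^sub>2, \<dots>) \<mapsto> (X h + n\<^sub>1, n\<^sub>2, n\<^sub>3, \<dots>)\<close> is a unitary extension of \<open>X\<close> to the sum of the
  second space and countably many copies of \<open>N\<close>, and it commutes with the diagonal extension of
  \<open>S\<close>. Extend \<open>E\<close> by sending the \<open>k\<close>-th copy of \<open>N\<close> through \<open>S\<close> into a new summand of the first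
  space, and extend \<open>V\<close> by an isometry that avoids these summands.
\<close>

section \<open>Adjoints and square roots\<close>

text \<open>Replacing \<open>x\<close> by \<open>\<i> *\<^sub>C x\<close> recovers the imaginary
  part, so later arguments can stay with the real inner product.\<close>

lemma cinner_eq_Complex: "cinner x y = Complex (inner x y) (- inner (\<i> *\<^sub>C x) y)"
  by (rule complex_eqI) (simp_all add: inner_eq_Re_cinner cinner_scaleC_left)

text \<open>Homogeneity of \<open>f\<close> and invariance of \<open>M\<close> under
  \<open>\<i>\<close> supply the imaginary part, so testing with the real inner product
  suffices.\<close>

lemma adj_onI:
  fixes f :: "'a::complex_inner \<Rightarrow> 'b::complex_inner"
  assumes M: "subspace M" "\<And>c x. x \<in> M \<Longrightarrow> c *\<^sub>C x \<in> M"
    and f: "\<And>c x. x \<in> M \<Longrightarrow> f (c *\<^sub>C x) = c *\<^sub>C f x"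
    and z: "z \<in> M" "\<And>x. x \<in> M \<Longrightarrow> inner (f x) y = inner x z"
  shows "adj_on M f y = z"
  unfolding adj_on_def
proof (rule the_equality)
  show "z \<in> M \<and> (\<forall>x\<in>M. cinner (f x) y = cinner x z)"
    using z(1) by (auto simp: cinner_eq_Complex z(2) M(2) simp flip: f)
next
  fix w assume w: "w \<in> M \<and> (\<forall>x\<in>M. cinner (f x) y = cinner x w)"
  have "inner x w = inner x z" if "x \<in> M" for x
    using w that z(2)[OF that] by (simp add: inner_eq_Re_cinner)
  from this[OF subspace_diff[OF M(1)], of w z] w z(1)
  have "inner (w - z) (w - z) = 0" by (simp add: inner_diff_right)
  then show "w = z" by simp
qed

lemma bounded_clinear_imp_bounded_linear: "bounded_clinear f \<Longrightarrow> bounded_linear f"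
  by (simp add: bounded_clinear_def)

lemma bounded_clinear_scaleC: "bounded_clinear f \<Longrightarrow> f (c *\<^sub>C x) = c *\<^sub>C f x"
  by (simp add: bounded_clinear_def)

lemma scaleC_zero [simp]: "c *\<^sub>C (0::'a::complex_inner) = 0"
  using scaleC_add_right[of c 0 "0::'a"] by simp

lemma scaleC_one: "1 *\<^sub>C x = x" for x :: "'a::complex_inner"
  using scaleC_of_real[of 1 x] by simp

lemma scaleC_uminus_left: "(- c) *\<^sub>C x = - (c *\<^sub>C x)" for x :: "'a::complex_inner"
  using scaleC_of_real[of "-1" "c *\<^sub>C x"] by (simp add: scaleC_scaleC)

lemma scaleC_minus: "c *\<^sub>C (- x) = - (c *\<^sub>C x)" for x :: "'a::complex_inner"
  using scaleC_add_right[of c x "- x"] by (simp add: eq_neg_iff_add_eq_0 add.commute)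

lemma scaleC_diff: "c *\<^sub>C (x - y) = c *\<^sub>C x - c *\<^sub>C y" for x :: "'a::complex_inner"
  using scaleC_add_right[of c x "- y"] by (simp add: scaleC_minus)

lemma bounded_clinear_id: "bounded_clinear (\<lambda>x. x)"
  by (simp add: bounded_clinear_def bounded_linear_ident)

lemma bounded_clinear_add:
  "bounded_clinear f \<Longrightarrow> bounded_clinear g \<Longrightarrow> bounded_clinear (\<lambda>x. f x + g x)"
  by (simp add: bounded_clinear_def bounded_linear_add scaleC_add_right)

lemma bounded_clinear_diff:
  "bounded_clinear f \<Longrightarrow> bounded_clinear g \<Longrightarrow> bounded_clinear (\<lambda>x. f x - g x)"
  by (simp add: bounded_clinear_def bounded_linear_sub scaleC_diff)

lemma bounded_clinear_compose:
  "bounded_clinear f \<Longrightarrow> bounded_clinear g \<Longrightarrow> bounded_clinear (\<lambda>x. f (g x))"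
  by (simp add: bounded_clinear_def bounded_linear_compose)

lemma bounded_linear_scaleC: "bounded_linear (\<lambda>x::'a::complex_inner. c *\<^sub>C x)"
  by (rule bounded_linear_intro[where K = "cmod c"])
    (simp_all add: scaleC_add_right norm_scaleC scaleC_scaleC mult.commute flip: scaleC_of_real)

text \<open>The representing vector minimises \<open>\<lambda>y. (norm y)\<^sup>2 - 2 * \<phi> y\<close> on the subspace.\<close>

lemma riesz_representation_on:
  fixes \<phi> :: "'a::{real_inner, complete_space} \<Rightarrow> real"
  assumes \<phi>: "bounded_linear \<phi>" and M: "closed M" "subspace M"
  shows "\<exists>y\<in>M. \<forall>z\<in>M. inner z y = \<phi> z"
proof -
  interpret \<phi>: bounded_linear \<phi> by (rule \<phi>)
  define J where "J y = (norm y)\<^sup>2 - 2 * \<phi> y" for y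
  obtain C where C: "\<And>y. norm (\<phi> y) \<le> norm y * C" using \<phi>.bounded by blast
  have lower: "- (C\<^sup>2) \<le> J y" for y
  proof -
    have "\<phi> y \<le> norm y * C" using C[of y] by (simp add: abs_le_iff)
    moreover have "0 \<le> (norm y - C)\<^sup>2" by simp
    ultimately show ?thesis by (simp add: J_def power2_diff)
  qed
  define m where "m = Inf (J ` M)"
  have bdd: "bdd_below (J ` M)" by (rule bdd_belowI2) (rule lower)
  have m_le: "m \<le> J y" if "y \<in> M" for y
    unfolding m_def using bdd that by (simp add: cInf_lower)
  have ne: "J ` M \<noteq> {}" using subspace_0[OF M(2)] by auto
  have "\<exists>y\<in>M. J y < m + 1 / real (Suc n)" for n
    using cInf_lessD[OF ne, of "m + 1 / real (Suc n)"] by (auto simp: m_def)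
  then obtain u where u: "\<And>n. u n \<in> M" "\<And>n. J (u n) < m + 1 / real (Suc n)" by metis
  \<comment> \<open>The parallelogram law, together with \<open>m \<le> J\<close> at the midpoint of
    \<open>a\<close> and \<open>b\<close>, makes the minimising sequence Cauchy.\<close>
  have par: "(norm (a - b))\<^sup>2 \<le> 2 * (J a - m) + 2 * (J b - m)" if "a \<in> M" "b \<in> M" for a b
  proof -
    have "(1/2) *\<^sub>R (a + b) \<in> M" using that M(2) by (simp add: subspace_add subspace_scale)
    from m_le[OF this] have "m \<le> (norm (a + b))\<^sup>2 / 4 - \<phi> a - \<phi> b"
      by (simp add: J_def \<phi>.scaleR \<phi>.add power_divide add_divide_distrib)
    moreover have "(norm (a + b))\<^sup>2 + (norm (a - b))\<^sup>2 = 2 * (norm a)\<^sup>2 + 2 * (norm b)\<^sup>2"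
      by (simp add: power2_norm_eq_inner inner_add inner_diff inner_commute)
    ultimately show ?thesis by (simp add: J_def)
  qed
  have "Cauchy u"
  proof (rule metric_CauchyI)
    fix e :: real assume e: "e > 0"
    then obtain N where N: "inverse (real (Suc N)) < e\<^sup>2 / 4"
      using reals_Archimedean[of "e\<^sup>2 / 4"] by auto
    have small: "J (u k) - m < e\<^sup>2 / 4" if "k \<ge> N" for k
    proof -
      have "1 / real (Suc k) \<le> inverse (real (Suc N))"
        using that by (simp add: field_simps)
      then show ?thesis using u(2)[of k] N by linarith
    qed
    have "dist (u j) (u k) < e" if "j \<ge> N" "k \<ge> N" for j k
    proof -
      have "(norm (u j - u k))\<^sup>2 < e\<^sup>2"
        using par[OF u(1) u(1), of j k] small[OF that(1)] small[OF that(2)] by argo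
      then show ?thesis using e by (simp add: dist_norm power2_less_imp_less)
    qed
    then show "\<exists>M. \<forall>m\<ge>M. \<forall>n\<ge>M. dist (u m) (u n) < e" by blast
  qed
  then obtain y where y: "u \<longlonglongrightarrow> y" using Cauchy_convergent_iff convergent_def by blast
  have yM: "y \<in> M" using M(1) u(1) y by (auto simp: closed_sequential_limits)
  have "(\<lambda>n. J (u n)) \<longlonglongrightarrow> J y"
    unfolding J_def by (intro tendsto_intros y \<phi>.tendsto)
  moreover have "(\<lambda>n. m + 1 / real (Suc n)) \<longlonglongrightarrow> m + 0"
    by (intro tendsto_intros LIMSEQ_inverse_real_of_nat[unfolded inverse_eq_divide])
  ultimately have Jy: "J y \<le> m"
    using u(2) by (auto intro: LIMSEQ_le less_imp_le)
  have "inner z y = \<phi> z" if z: "z \<in> M" for z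
  proof (cases "z = 0")
    case False
    define d where "d = inner z y - \<phi> z"
    \<comment> \<open>The quadratic polynomial \<open>J (y + t *\<^sub>R z)\<close> in
      \<open>t\<close> has its minimum here; it would lie below \<open>J y\<close> unless
      \<open>d = 0\<close>.\<close>
    define t where "t = - d / (norm z)\<^sup>2"
    have nz: "(norm z)\<^sup>2 > 0" using False by simp
    have "y + t *\<^sub>R z \<in> M" using yM z M(2) by (simp add: subspace_add subspace_scale)
    then have "J y \<le> J (y + t *\<^sub>R z)" using Jy m_le by fastforce
    also have "\<dots> = J y + 2 * t * d + t\<^sup>2 * (norm z)\<^sup>2"
      unfolding J_def d_def power2_norm_eq_inner
      by (simp add: \<phi>.add \<phi>.scaleR inner_add inner_commute algebra_simps power2_eq_square)
    finally have "0 \<le> 2 * t * d + t\<^sup>2 * (norm z)\<^sup>2" by simp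
    also have "\<dots> = - d\<^sup>2 / (norm z)\<^sup>2"
      using nz by (simp add: t_def field_simps power2_eq_square)
    finally have "d\<^sup>2 \<le> 0" using nz by (simp add: divide_simps)
    then show ?thesis by (simp add: d_def)
  qed (simp add: \<phi>.zero)
  with yM show ?thesis by blast
qed

lemma bounded_linear_ex_adjoint:
  fixes f :: "'a::{real_inner, complete_space} \<Rightarrow> 'b::real_inner"
  assumes "bounded_linear f"
  shows "\<exists>z. \<forall>x. inner (f x) y = inner x z"
  using riesz_representation_on[OF bounded_linear_compose[OF bounded_linear_inner_left assms],
      of UNIV y]
  by (auto simp: eq_commute)

lemma inner_adj:
  fixes f :: "'a::chilbert_space \<Rightarrow> 'b::complex_inner"
  assumes "bounded_clinear f"
  shows "inner (f x) y = inner x (adj f y)"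
proof -
  obtain z where "\<And>x. inner (f x) y = inner x z"
    using bounded_linear_ex_adjoint assms bounded_clinear_imp_bounded_linear by blast
  moreover from this have "adj f y = z"
    using assms by (intro adj_onI) (auto simp: bounded_clinear_scaleC)
  ultimately show ?thesis by simp
qed

lemma adjI:
  assumes "bounded_clinear f" "\<And>x. inner (f x) y = inner x z"
  shows "adj f y = z"
  using assms by (intro adj_onI) (auto simp: bounded_clinear_scaleC)

lemma inner_scaleC_right: "inner x (c *\<^sub>C y) = inner (cnj c *\<^sub>C x) y"
  by (simp add: inner_eq_Re_cinner cinner_scaleC_left cinner_commute[of x "c *\<^sub>C y"]
      cinner_commute[of y x])

lemma bounded_clinear_adj:
  fixes f :: "'a::chilbert_space \<Rightarrow> 'b::complex_inner"
  assumes f: "bounded_clinear f"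
  shows "bounded_clinear (adj f)"
proof -
  note ia = inner_adj[OF f, symmetric]
  have add: "adj f (y + z) = adj f y + adj f z" for y z
    by (rule adjI[OF f]) (simp add: inner_add ia)
  have scC: "adj f (c *\<^sub>C y) = c *\<^sub>C adj f y" for c y
    by (rule adjI[OF f]) (simp add: inner_scaleC_right ia bounded_clinear_scaleC[OF f])
  obtain C where C: "C > 0" "\<And>x. norm (f x) \<le> norm x * C"
    using bounded_linear.pos_bounded[OF bounded_clinear_imp_bounded_linear[OF f]] by blast
  have "norm (adj f y) \<le> norm y * C" for y
  proof (cases "adj f y = 0")
    case False
    have "(norm (adj f y))\<^sup>2 = inner (f (adj f y)) y" by (simp add: power2_norm_eq_inner ia)
    also have "\<dots> \<le> norm (f (adj f y)) * norm y" by (rule norm_cauchy_schwarz)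
    also have "\<dots> \<le> norm (adj f y) * C * norm y" by (simp add: C(2) mult_right_mono)
    finally show ?thesis using False by (simp add: power2_eq_square mult_ac)
  qed (use C(1) in simp)
  then have "bounded_linear (adj f)"
    using add scC by (intro bounded_linear_intro[where K = C]) (auto simp flip: scaleC_of_real)
  then show ?thesis using scC by (simp add: bounded_clinear_def)
qed

section \<open>Square roots of positive operators\<close>

text \<open>Positivity is evaluated at \<open>x - (1/C) *\<^sub>R A x\<close>, and the term cubic in
  \<open>A\<close> is bounded through \<open>C\<close>.\<close>

lemma positive_norm_sq_le:
  fixes A :: "'a::real_inner \<Rightarrow> 'a"
  assumes A: "bounded_linear A" and sym: "\<And>x y. inner (A x) y = inner x (A y)"
    and pos: "\<And>x. 0 \<le> inner (A x) x" and C: "C > 0" "\<And>x. norm (A x) \<le> norm x * C"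
  shows "(norm (A x))\<^sup>2 \<le> C * inner (A x) x"
proof -
  interpret A: bounded_linear A by (rule A)
  have "0 \<le> inner (A (x - (1/C) *\<^sub>R A x)) (x - (1/C) *\<^sub>R A x)" by (rule pos)
  also have "\<dots> = inner (A x) x - 2 / C * (norm (A x))\<^sup>2 + inner (A (A x)) (A x) / C\<^sup>2"
    using sym[of x "A x"]
    by (simp add: A.diff A.scaleR inner_diff power2_norm_eq_inner inner_commute
        power2_eq_square[of C])
  also have "inner (A (A x)) (A x) / C\<^sup>2 \<le> (norm (A x) * C) * norm (A x) / C\<^sup>2"
    by (intro divide_right_mono order_trans[OF norm_cauchy_schwarz] mult_right_mono C) auto
  also have "\<dots> = (norm (A x))\<^sup>2 / C" using C(1) by (simp add: power2_eq_square)
  finally have "(norm (A x))\<^sup>2 / C \<le> inner (A x) x" by simp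
  then show ?thesis using C(1) by (simp add: field_simps)
qed

lemma positive_eq_0:
  fixes A :: "'a::real_inner \<Rightarrow> 'a"
  assumes A: "bounded_linear A" and sym: "\<And>x y. inner (A x) y = inner x (A y)"
    and pos: "\<And>x. 0 \<le> inner (A x) x" and "inner (A x) x = 0"
  shows "A x = 0"
proof -
  obtain C where "C > 0" "\<And>x. norm (A x) \<le> norm x * C"
    using bounded_linear.pos_bounded[OF A] by blast
  from positive_norm_sq_le[OF A sym pos this, of x] assms(4) show ?thesis by simp
qed

lemma blinfun_compose_assoc: "(f o\<^sub>L g) o\<^sub>L h = f o\<^sub>L (g o\<^sub>L h)"
  by (rule blinfun_eqI) simp

text \<open>
  The iteration \<open>Y \<mapsto> (B + Y\<^sup>2) / 2\<close> solves \<open>(1 - Y)\<^sup>2 = 1 - B\<close>; it is dominated in norm by the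
  same iteration for the scalar \<open>1\<close>, whose increasing iterates are bounded by \<open>1\<close>.
\<close>

lemma contraction_fixpoint_half_square:
  fixes B :: "'a::banach \<Rightarrow>\<^sub>L 'a"
  assumes B: "norm B \<le> 1"
  shows "\<exists>Y L. Y \<longlonglongrightarrow> L \<and> Y 0 = 0 \<and> (\<forall>n. Y (Suc n) = (1/2) *\<^sub>R (B + (Y n o\<^sub>L Y n))) \<and>
    norm L \<le> 1 \<and> L = (1/2) *\<^sub>R (B + (L o\<^sub>L L))"
proof -
  define Y where "Y = rec_nat (0::'a \<Rightarrow>\<^sub>L 'a) (\<lambda>_ Z. (1/2) *\<^sub>R (B + (Z o\<^sub>L Z)))"
  have Y: "Y 0 = 0" "\<And>n. Y (Suc n) = (1/2) *\<^sub>R (B + (Y n o\<^sub>L Y n))" by (simp_all add: Y_def)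
  define y where "y = rec_nat (0::real) (\<lambda>_ z. (1 + z\<^sup>2) / 2)"
  have y: "y 0 = 0" "\<And>n. y (Suc n) = (1 + (y n)\<^sup>2) / 2" by (simp_all add: y_def)
  note bil = bounded_bilinear_blinfun_compose
  have comB: "Z o\<^sub>L Y n = Y n o\<^sub>L Z" if "Z o\<^sub>L B = B o\<^sub>L Z" for Z n
  proof (induction n)
    case 0 then show ?case by (simp add: Y bounded_bilinear.zero_left[OF bil]
          bounded_bilinear.zero_right[OF bil])
  next
    case (Suc n)
    have "Z o\<^sub>L (Y n o\<^sub>L Y n) = (Y n o\<^sub>L Y n) o\<^sub>L Z"
      by (metis Suc blinfun_compose_assoc)
    then show ?case
      by (simp add: Y that bounded_bilinear.scaleR_left[OF bil] bounded_bilinear.scaleR_right[OF bil]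
          bounded_bilinear.add_left[OF bil] bounded_bilinear.add_right[OF bil])
  qed
  have com: "Y m o\<^sub>L Y n = Y n o\<^sub>L Y m" for m n
    using comB[of B m] by (intro comB) simp
  have y_bd: "0 \<le> y n \<and> y n \<le> 1" for n
  proof (induction n)
    case (Suc n) then show ?case using power_le_one[of "y n" 2] by (simp add: y)
  qed (simp add: y)
  have y_mono: "y n \<le> y (Suc n)" for n
    using zero_le_power2[of "y n - 1"] by (simp add: y power2_diff)
  have Y_bd: "norm (Y n) \<le> y n" for n
  proof (induction n)
    case (Suc n)
    have "norm (Y n o\<^sub>L Y n) \<le> (y n)\<^sup>2"
      unfolding power2_eq_square using Suc y_bd[of n]
      by (intro order_trans[OF norm_blinfun_compose] mult_mono) auto
    then show ?case using B norm_triangle_ineq[of B "Y n o\<^sub>L Y n"] by (simp add: Y y)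
  qed (simp add: Y y)
  \<comment> \<open>The iterates commute, so the difference of two squares factors as in the scalar
    case; thus the increments of \<open>Y\<close> are dominated by those of
    \<open>y\<close>.\<close>
  have step: "norm (Y (Suc n) - Y n) \<le> y (Suc n) - y n" for n
  proof (induction n)
    case 0 then show ?case using B by (simp add: Y y bounded_bilinear.zero_left[OF bil])
  next
    case (Suc n)
    have "Y (Suc (Suc n)) - Y (Suc n) =
        (1/2) *\<^sub>R (B + (Y (Suc n) o\<^sub>L Y (Suc n))) - (1/2) *\<^sub>R (B + (Y n o\<^sub>L Y n))"
      by (intro arg_cong2[where f = "(-)"] Y)
    also have "\<dots> = (1/2) *\<^sub>R ((Y (Suc n) + Y n) o\<^sub>L (Y (Suc n) - Y n))"
      by (simp add: com[of n "Suc n"] bounded_bilinear.add_left[OF bil]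
          bounded_bilinear.diff_right[OF bil] flip: scaleR_diff_right)
    finally have "Y (Suc (Suc n)) - Y (Suc n) = \<dots>" .
    moreover have "norm ((Y (Suc n) + Y n) o\<^sub>L (Y (Suc n) - Y n))
        \<le> (y (Suc n) + y n) * (y (Suc n) - y n)"
      using Y_bd[of n] Y_bd[of "Suc n"] Suc y_bd[of n] y_bd[of "Suc n"]
        norm_triangle_ineq[of "Y (Suc n)" "Y n"]
      by (intro order_trans[OF norm_blinfun_compose] mult_mono) auto
    moreover have "(y (Suc n) + y n) * (y (Suc n) - y n) = 2 * (y (Suc (Suc n)) - y (Suc n))"
      unfolding y(2)[of "Suc n"] by (simp add: y(2)[of n] field_simps power2_eq_square)
    ultimately show ?case by simp
  qed
  have "summable (\<lambda>n. Y (Suc n) - Y n)"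
  proof (rule summable_comparison_test'[OF _ step])
    have "incseq y" using y_mono by (rule incseq_SucI)
    then have "convergent y"
      using y_bd by (intro Bseq_mono_convergent BseqI'[of _ 1]) (auto simp: incseq_def)
    then show "summable (\<lambda>n. y (Suc n) - y n)"
      by (auto simp: convergent_def intro: telescope_summable)
  qed
  then have "convergent (\<lambda>n. \<Sum>k<n. Y (Suc k) - Y k)" by (simp add: summable_iff_convergent)
  then have "convergent Y" by (simp only: sum_lessThan_telescope Y(1) diff_zero)
  then obtain L where L: "Y \<longlonglongrightarrow> L" by (auto simp: convergent_def)
  have "norm L \<le> 1"
    using y_bd Y_bd by (intro LIMSEQ_le_const2[OF tendsto_norm[OF L]]) (meson order_trans)
  moreover have "(\<lambda>n. Y (Suc n)) \<longlonglongrightarrow> (1/2) *\<^sub>R (B + (L o\<^sub>L L))"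
    unfolding Y by (intro tendsto_intros L bounded_bilinear.tendsto[OF bil])
  then have "L = (1/2) *\<^sub>R (B + (L o\<^sub>L L))" using LIMSEQ_Suc[OF L] LIMSEQ_unique by blast
  ultimately show ?thesis using L Y by blast
qed

text \<open>With \<open>B = 1 - A/C\<close>, a contraction by \<open>positive_norm_sq_le\<close>,
  the limit \<open>L\<close> of the iteration satisfies \<open>(1 - L)\<^sup>2 = A/C\<close>, which
  gives the root \<open>sqrt C\<close> times \<open>1 - L\<close>. Commutation with \<open>Z\<close>
  passes from the iterates to the limit; it later yields complex linearity and uniqueness.\<close>

lemma positive_sqrt_exists:
  fixes A :: "'a::{real_inner, banach} \<Rightarrow> 'a"
  assumes A: "bounded_linear A" and sym: "\<And>x y. inner (A x) y = inner x (A y)"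
    and pos: "\<And>x. 0 \<le> inner (A x) x"
  shows "\<exists>S. bounded_linear S \<and> (\<forall>x y. inner (S x) y = inner x (S y)) \<and>
    (\<forall>x. 0 \<le> inner (S x) x) \<and> (\<forall>x. S (S x) = A x) \<and>
    (\<forall>Z. bounded_linear Z \<longrightarrow> (\<forall>x. Z (A x) = A (Z x)) \<longrightarrow> (\<forall>x. Z (S x) = S (Z x)))"
proof -
  obtain C where C: "C > 0" "\<And>x. norm (A x) \<le> norm x * C"
    using bounded_linear.pos_bounded[OF A] by blast
  define B where "B = id_blinfun - (1/C) *\<^sub>R Blinfun A"
  have B: "blinfun_apply B x = x - (1/C) *\<^sub>R A x" for x
    by (simp add: B_def blinfun.diff_left blinfun.scaleR_left bounded_linear_Blinfun_apply[OF A])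
  have "norm (B x) \<le> norm x" for x
  proof -
    have "(norm (B x))\<^sup>2 = (norm x)\<^sup>2 - 2 / C * inner (A x) x + (norm (A x))\<^sup>2 / C\<^sup>2"
      by (simp add: B power2_norm_eq_inner inner_diff inner_commute power2_eq_square[of C])
    also have "(norm (A x))\<^sup>2 / C\<^sup>2 \<le> (C * inner (A x) x) / C\<^sup>2"
      by (intro divide_right_mono positive_norm_sq_le[OF A sym pos C]) auto
    also have "\<dots> = inner (A x) x / C" using C(1) by (simp add: power2_eq_square)
    finally have "(norm (B x))\<^sup>2 \<le> (norm x)\<^sup>2 - inner (A x) x / C" by simp
    moreover have "0 \<le> inner (A x) x / C" using C(1) pos by simp
    ultimately have "(norm (B x))\<^sup>2 \<le> (norm x)\<^sup>2" by linarith
    then show ?thesis by (rule power2_le_imp_le) simp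
  qed
  then have "norm B \<le> 1" by (intro norm_blinfun_bound) auto
  then obtain Y L where YL: "Y \<longlonglongrightarrow> L" and Y0: "Y 0 = 0"
    and Y: "\<And>n. Y (Suc n) = (1/2) *\<^sub>R (B + (Y n o\<^sub>L Y n))"
    and L: "norm L \<le> 1" "L = (1/2) *\<^sub>R (B + (L o\<^sub>L L))"
    using contraction_fixpoint_half_square by metis
  have lim: "(\<lambda>n. blinfun_apply (Y n) x) \<longlonglongrightarrow> L x" for x
    by (intro tendsto_intros YL)
  have Yx: "blinfun_apply (Y (Suc n)) x = (1/2) *\<^sub>R (B x + Y n (Y n x))" for n x
    by (simp add: Y blinfun.add_left blinfun.scaleR_left)
  have symY: "inner (Y n x) z = inner x (Y n z)" for n x z
  proof (induction n arbitrary: x z)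
    case (Suc n)
    then show ?case by (simp add: Yx B inner_add inner_diff sym)
  qed (simp add: Y0)
  have symL: "inner (L x) z = inner x (L z)" for x z
  proof (rule LIMSEQ_unique)
    show "(\<lambda>n. inner x (Y n z)) \<longlonglongrightarrow> inner (L x) z"
      unfolding symY[symmetric] by (intro tendsto_intros lim)
    show "(\<lambda>n. inner x (Y n z)) \<longlonglongrightarrow> inner x (L z)"
      by (intro tendsto_intros lim)
  qed
  have comL: "Z (L x) = L (Z x)" if Z: "bounded_linear Z" "\<And>x. Z (A x) = A (Z x)" for Z x
  proof -
    interpret Z: bounded_linear Z by (rule Z(1))
    have comY: "Z (Y n x) = Y n (Z x)" for n x
    proof (induction n arbitrary: x)
      case (Suc n)
      then show ?case by (simp add: Yx B Z.add Z.diff Z.scaleR Z(2))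
    qed (simp add: Y0 Z.zero)
    show ?thesis
      using LIMSEQ_unique[OF Z.tendsto[OF lim[of x]]] lim[of "Z x"] by (simp add: comY)
  qed
  have LL: "L (L x) = 2 *\<^sub>R L x - x + (1/C) *\<^sub>R A x" for x
  proof -
    have "2 *\<^sub>R L x = B x + L (L x)"
      by (subst (1) L(2)) (simp add: blinfun.add_left blinfun.scaleR_left)
    then show ?thesis by (simp add: B algebra_simps)
  qed
  define S where "S x = sqrt C *\<^sub>R (x - L x)" for x
  have "bounded_linear S"
    unfolding S_def by (intro bounded_linear_intros)
  moreover have "inner (S x) y = inner x (S y)" for x y
    by (simp add: S_def inner_diff symL)
  moreover have "0 \<le> inner (S x) x" for x
  proof -
    have "inner (L x) x \<le> norm (L x) * norm x" by (rule norm_cauchy_schwarz)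
    also have "\<dots> \<le> (1 * norm x) * norm x"
      by (intro mult_right_mono order_trans[OF norm_blinfun]) (auto intro: L(1))
    finally have "inner (L x) x \<le> inner x x"
      by (simp add: power2_norm_eq_inner[symmetric] power2_eq_square)
    then show ?thesis using C(1) by (simp add: S_def inner_diff)
  qed
  moreover have "S (S x) = A x" for x
  proof -
    have "S (S x) = C *\<^sub>R (x - 2 *\<^sub>R L x + L (L x))"
      using C(1) by (simp add: S_def blinfun.diff_right blinfun.scaleR_right algebra_simps
          scaleR_2)
    also have "\<dots> = A x" using C(1) by (simp add: LL)
    finally show ?thesis .
  qed
  moreover have "Z (S x) = S (Z x)" if "bounded_linear Z" "\<And>x. Z (A x) = A (Z x)" for Z x
    using comL[OF that] by (simp add: S_def linear_simps[OF that(1)])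
  ultimately show ?thesis by blast
qed

text \<open>Reality of the form at \<open>x + \<i> *\<^sub>C y\<close> polarises to symmetry.
  Conversely, symmetry makes \<open>inner (\<i> *\<^sub>C A x) x\<close> equal to its own
  negative.\<close>

lemma positive_op_iff:
  "positive_op A \<longleftrightarrow> bounded_clinear A \<and> (\<forall>x y. inner (A x) y = inner x (A y)) \<and>
     (\<forall>x. 0 \<le> inner (A x) x)"
proof safe
  assume A: "positive_op A"
  then have bc: "bounded_clinear A" by (simp add: positive_op_def)
  then show "bounded_clinear A" .
  interpret A: bounded_linear A by (rule bounded_clinear_imp_bounded_linear[OF bc])
  have real: "Im (cinner (A x) x) = 0" "0 \<le> Re (cinner (A x) x)" for x
    using A by (auto simp: positive_op_def complex_nonneg_Reals_iff)
  then show "0 \<le> inner (A x) x" for x by (simp add: inner_eq_Re_cinner)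
  have im: "inner (\<i> *\<^sub>C A x) x = 0" for x
    using real(1)[of x] by (simp add: cinner_eq_Complex)
  show "inner (A x) y = inner x (A y)" for x y
  proof -
    have "inner (\<i> *\<^sub>C A x) (\<i> *\<^sub>C y) = inner (A x) y"
      by (simp add: inner_scaleC_right scaleC_scaleC scaleC_one)
    moreover have "inner (A y) (\<i> *\<^sub>C y) = 0"
      using im[of y] by (simp add: inner_scaleC_right scaleC_uminus_left)
    moreover have "\<i> *\<^sub>C A (x + \<i> *\<^sub>C y) = \<i> *\<^sub>C A x - A y"
      by (simp add: A.add bounded_clinear_scaleC[OF bc] scaleC_add_right scaleC_scaleC
          scaleC_uminus_left scaleC_one)
    ultimately show ?thesis
      using im[of "x + \<i> *\<^sub>C y"] im[of x]
      by (simp add: inner_add_right inner_diff_left inner_commute[of "A y" x])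
  qed
next
  assume A: "bounded_clinear A" "\<forall>x y. inner (A x) y = inner x (A y)" "\<forall>x. 0 \<le> inner (A x) x"
  have "inner (\<i> *\<^sub>C A x) x = 0" for x
  proof -
    have "inner (\<i> *\<^sub>C A x) x = inner (A (\<i> *\<^sub>C x)) x"
      by (simp add: bounded_clinear_scaleC[OF A(1)])
    also have "\<dots> = inner (\<i> *\<^sub>C x) (A x)" using A(2) by blast
    also have "\<dots> = inner (A x) (\<i> *\<^sub>C x)" by (rule inner_commute)
    also have "\<dots> = - inner (\<i> *\<^sub>C A x) x"
      by (simp add: inner_scaleC_right scaleC_uminus_left)
    finally show ?thesis by simp
  qed
  then show "positive_op A"
    using A(1,3) by (simp add: positive_op_def complex_nonneg_Reals_iff cinner_eq_Complex)
qed

lemma op_sqrt_exists_unique: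
  fixes A :: "'a::chilbert_space \<Rightarrow> 'a"
  assumes "positive_op A"
  shows "\<exists>!S. positive_op S \<and> S \<circ> S = A"
proof -
  from assms have A: "bounded_clinear A" "\<And>x y. inner (A x) y = inner x (A y)"
    "\<And>x. 0 \<le> inner (A x) x" by (auto simp: positive_op_iff)
  obtain S where S: "bounded_linear S" "\<And>x y. inner (S x) y = inner x (S y)"
    "\<And>x. 0 \<le> inner (S x) x" "\<And>x. S (S x) = A x"
    and comm: "\<And>Z x. bounded_linear Z \<Longrightarrow> (\<And>x. Z (A x) = A (Z x)) \<Longrightarrow> Z (S x) = S (Z x)"
    using positive_sqrt_exists[OF bounded_clinear_imp_bounded_linear[OF A(1)] A(2,3)] by metis
  \<comment> \<open>Multiplication by \<open>c\<close> is bounded, real linear and commutes with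
    \<open>A\<close>, hence is an admissible \<open>Z\<close>.\<close>
  have "c *\<^sub>C S x = S (c *\<^sub>C x)" for c x
    using bounded_linear_scaleC by (rule comm) (simp add: bounded_clinear_scaleC[OF A(1)])
  with S(1) have bcS: "bounded_clinear S" by (simp add: bounded_clinear_def)
  interpret S: bounded_linear S by (rule S(1))
  show ?thesis
  proof (rule ex1I)
    show "positive_op S \<and> S \<circ> S = A"
      using S bcS by (auto simp: positive_op_iff fun_eq_iff)
  next
    fix R assume R: "positive_op R \<and> R \<circ> R = A"
    then have R': "bounded_linear R" "\<And>x y. inner (R x) y = inner x (R y)"
      "\<And>x. 0 \<le> inner (R x) x" "\<And>x. R (R x) = A x"
      by (auto simp: positive_op_iff bounded_clinear_def fun_eq_iff)
    interpret R: bounded_linear R by (rule R'(1))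
    have RS: "R (S x) = S (R x)" for x
      using R'(1) by (rule comm) (simp flip: R'(4))
    show "R = S"
    proof
      fix x
      \<comment> \<open>The commuting roots have equal squares, so \<open>R + S\<close> kills
        \<open>d\<close>. By positivity both forms vanish at \<open>d\<close>, hence so do
        \<open>R d\<close> and \<open>S d\<close>.\<close>
      define d where "d = R x - S x"
      have "R d + S d = 0" by (simp add: d_def R.diff S.diff RS R'(4) S(4))
      then have "inner (R d) d + inner (S d) d = 0" by (simp flip: inner_add_left)
      then have "inner (R d) d = 0" "inner (S d) d = 0"
        using R'(3)[of d] S(3)[of d] by linarith+
      then have "R d = 0" "S d = 0"
        using positive_eq_0[OF R'(1-3)] positive_eq_0[OF S(1-3)] by auto
      moreover have "inner d d = inner (R x) d - inner (S x) d"
        by (simp add: d_def inner_diff_left)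
      ultimately have "inner d d = 0" by (simp add: R'(2) S(2))
      then show "R x = S x" by (simp add: d_def)
    qed
  qed
qed

lemma
  fixes A :: "'a::chilbert_space \<Rightarrow> 'a"
  assumes "positive_op A"
  shows positive_op_sqrt: "positive_op (op_sqrt A)"
    and op_sqrt_square: "op_sqrt A (op_sqrt A x) = A x"
proof -
  have "positive_op (op_sqrt A) \<and> op_sqrt A \<circ> op_sqrt A = A"
    unfolding op_sqrt_def by (rule theI'[OF op_sqrt_exists_unique[OF assms]])
  then show "positive_op (op_sqrt A)" "op_sqrt A (op_sqrt A x) = A x"
    by (auto dest: fun_cong[where x = x])
qed

section \<open>Orthogonal projections and 2-isometries\<close>

lemma inner_extI: "(\<And>y. inner x y = inner z y) \<Longrightarrow> x = z" for x z :: "'a::real_inner"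
  using inner_eq_zero_iff[of "x - z"] by (simp add: inner_diff_left del: inner_eq_zero_iff)

lemma cinner_eq_0I:
  assumes "\<And>c. inner x (c *\<^sub>C y) = 0"
  shows "cinner x y = 0"
proof -
  have "inner x y = 0" using assms[of 1] by (simp add: scaleC_one)
  moreover have "inner (\<i> *\<^sub>C x) y = 0"
    using assms[of "- \<i>"] by (simp add: inner_scaleC_right)
  ultimately show ?thesis by (simp add: cinner_eq_Complex Complex_eq_0)
qed

lemma orth_projI:
  assumes M: "subspace M" "\<And>c x. x \<in> M \<Longrightarrow> c *\<^sub>C x \<in> M"
    and y: "y \<in> M" "\<And>z. z \<in> M \<Longrightarrow> inner (x - y) z = 0"
  shows "orth_proj M x = y"
  unfolding orth_proj_def
proof (rule the_equality)
  show "y \<in> M \<and> (\<forall>z\<in>M. cinner (x - y) z = 0)"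
    using y M(2) by (auto intro: cinner_eq_0I)
next
  fix w assume w: "w \<in> M \<and> (\<forall>z\<in>M. cinner (x - w) z = 0)"
  then have "w - y \<in> M" using y(1) M(1) by (simp add: subspace_diff)
  then have "inner (x - w) (w - y) = 0" "inner (x - y) (w - y) = 0"
    using w y(2) by (simp_all add: inner_eq_Re_cinner)
  then have "inner (w - y) (w - y) = 0" by (simp add: inner_diff_left)
  then show "w = y" by simp
qed

lemma closed_csubspace_kernel:
  assumes "bounded_clinear f"
  shows "closed_csubspace {x. f x = 0}"
proof -
  interpret f: bounded_linear f by (rule bounded_clinear_imp_bounded_linear[OF assms])
  have "closed {x. f x = 0}"
    by (rule closed_Collect_eq[OF f.continuous_on[OF continuous_on_id] continuous_on_const])
  then show ?thesis
    using bounded_clinear_scaleC[OF assms]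
    by (auto simp: closed_csubspace_def subspace_def f.zero f.add f.scaleR)
qed

text \<open>Applied to \<open>Q\<close> on the given space and to \<open>K\<close> on the sequence
  space: the kernel is the first summand, the range the second.\<close>

lemma
  assumes P: "bounded_clinear P" and sym: "\<And>x y. inner (P x) y = inner x (P y)"
    and idem: "\<And>x. P (P x) = P x"
  shows orth_decomp_kernel_fixed: "orth_decomp {x. P x = 0} {x. P x = x}"
    and orth_proj_fixed: "orth_proj {x. P x = x} x = P x"
    and orth_proj_kernel: "orth_proj {x. P x = 0} x = x - P x"
proof -
  interpret P: bounded_linear P by (rule bounded_clinear_imp_bounded_linear[OF P])
  have ker: "closed_csubspace {x. P x = 0}" by (rule closed_csubspace_kernel[OF P])
  from closed_csubspace_kernel[OF bounded_clinear_diff[OF P bounded_clinear_id]]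
  have fixd: "closed_csubspace {x. P x = x}" by simp
  have orth: "inner x y = 0" if "P x = 0" "P y = y" for x y
    using sym[of x y] that by simp
  have "cinner x y = 0" if "P x = 0" "P y = y" for x y
    using that by (intro cinner_eq_0I orth) (simp_all add: bounded_clinear_scaleC[OF P])
  moreover have "\<exists>y\<in>{x. P x = 0}. \<exists>z\<in>{x. P x = x}. x = y + z" for x
    by (rule bexI[of _ "x - P x"], rule bexI[of _ "P x"]) (simp_all add: P.diff idem)
  ultimately show "orth_decomp {x. P x = 0} {x. P x = x}"
    using ker fixd by (auto simp: orth_decomp_def)
  show "orth_proj {x. P x = x} x = P x"
    using fixd by (intro orth_projI) (auto simp: closed_csubspace_def idem P.diff intro: orth)
  show "orth_proj {x. P x = 0} x = x - P x"
    using ker orth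
    by (intro orth_projI) (auto simp: closed_csubspace_def idem P.diff inner_commute)
qed

text \<open>The projection of \<open>x\<close> is the Riesz representative on \<open>M\<close> of
  the inner product with \<open>x\<close>.\<close>

lemma orthogonal_projection_exists:
  fixes M :: "'a::chilbert_space set"
  assumes M: "closed_csubspace M"
  shows "\<exists>P. bounded_clinear P \<and> (\<forall>x y. inner (P x) y = inner x (P y)) \<and>
    (\<forall>x. P (P x) = P x) \<and> (\<forall>x. P x = x \<longleftrightarrow> x \<in> M)"
proof -
  from M have M': "closed M" "subspace M" "\<And>c x. x \<in> M \<Longrightarrow> c *\<^sub>C x \<in> M"
    by (auto simp: closed_csubspace_def)
  have "\<exists>y\<in>M. \<forall>z\<in>M. inner z y = inner z x" for x
    using riesz_representation_on[OF bounded_linear_inner_left M'(1,2), of x] .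
  then obtain P where P: "\<And>x. P x \<in> M" "\<And>x z. z \<in> M \<Longrightarrow> inner z (P x) = inner z x"
    by metis
  have uniq: "P x = y" if "y \<in> M" "\<And>z. z \<in> M \<Longrightarrow> inner z y = inner z x" for x y
  proof -
    have "P x - y \<in> M" using P(1) that(1) M'(2) by (simp add: subspace_diff)
    then have "inner (P x - y) (P x) = inner (P x - y) y" by (simp add: P(2) that(2))
    then have "inner (P x - y) (P x - y) = 0" by (simp add: inner_diff_right)
    then show ?thesis by simp
  qed
  have add: "P (x + y) = P x + P y" for x y
    by (rule uniq) (simp_all add: P subspace_add[OF M'(2)] inner_add_right)
  have scC: "P (c *\<^sub>C x) = c *\<^sub>C P x" for c x
    by (rule uniq) (simp_all add: P M'(3) inner_scaleC_right)
  have "norm (P x) \<le> norm x * 1" for x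
  proof (cases "P x = 0")
    case False
    have "norm (P x) * norm (P x) = inner (P x) x"
      using P(2)[OF P(1), of x x] by (simp add: power2_norm_eq_inner flip: power2_eq_square)
    also have "\<dots> \<le> norm (P x) * norm x" by (rule norm_cauchy_schwarz)
    finally show ?thesis using False by simp
  qed simp
  then have "bounded_linear P"
    using add scC by (intro bounded_linear_intro[where K = 1]) (auto simp flip: scaleC_of_real)
  then have "bounded_clinear P" using scC by (simp add: bounded_clinear_def)
  moreover have "inner (P x) y = inner x (P y)" for x y
    using P(2)[OF P(1), of x y] P(2)[OF P(1), of y x] by (simp add: inner_commute)
  moreover have fixd: "P x = x \<longleftrightarrow> x \<in> M" for x
    using P(1)[of x] uniq[of x x] by auto
  ultimately show ?thesis using P(1) by blast
qed

section \<open>The defect operator of a 2-isometry\<close>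

lemma two_isometryD:
  assumes "two_isometry T"
  shows "bounded_clinear T"
    and "adj T (adj T (T (T x))) = 2 *\<^sub>R adj T (T x) - x"
proof -
  show "bounded_clinear T" using assms by (simp add: two_isometry_def)
  have "adj T (adj T (T (T x))) - 2 *\<^sub>R adj T (T x) + x = 0"
    using assms by (simp add: two_isometry_def)
  then show "adj T (adj T (T (T x))) = 2 *\<^sub>R adj T (T x) - x"
    by (simp add: algebra_simps eq_neg_iff_add_eq_0)
qed

text \<open>A regrouping of the 2-isometry identity. This invariance drives the induction for
  positivity and later shows that \<open>X\<close> is isometric.\<close>

lemma adj_defect:
  fixes T :: "'a::chilbert_space \<Rightarrow> 'a"
  assumes "two_isometry T"
  shows "adj T (defect T (T x)) = defect T x"
proof -
  interpret bounded_linear "adj T"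
    by (intro bounded_clinear_imp_bounded_linear bounded_clinear_adj two_isometryD(1)[OF assms])
  show ?thesis by (simp add: defect_def diff two_isometryD(2)[OF assms] scaleR_2)
qed

text \<open>
  By induction \<open>(norm ((T ^^ n) x))\<^sup>2 = (norm x)\<^sup>2 + n * inner (defect T x) x\<close>, and the
  left-hand side is nonnegative for all \<open>n\<close>.
\<close>

lemma positive_defect:
  fixes T :: "'a::chilbert_space \<Rightarrow> 'a"
  assumes T2: "two_isometry T"
  shows "positive_op (defect T)"
proof -
  note T = two_isometryD(1)[OF T2]
  have ia: "inner (adj T y) x = inner y (T x)" for x y
    using inner_adj[OF T, of x y] by (simp add: inner_commute)
  have bc: "bounded_clinear (defect T)"
    using bounded_clinear_diff[OF bounded_clinear_compose[OF bounded_clinear_adj[OF T] T]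
        bounded_clinear_id]
    by (simp flip: defect_def)
  have sym: "inner (defect T x) y = inner x (defect T y)" for x y
    by (simp add: defect_def inner_diff ia inner_adj[OF T, symmetric])
  have step: "inner (defect T (T x)) (T x) = inner (defect T x) x" for x
    using adj_defect[OF T2, of x] by (simp flip: ia)
  have nrm: "inner (T x) (T x) = inner x x + inner (defect T x) x" for x
    by (simp add: defect_def inner_diff_left ia)
  have iter: "inner ((T ^^ n) x) ((T ^^ n) x) = inner x x + real n * inner (defect T x) x \<and>
      inner (defect T ((T ^^ n) x)) ((T ^^ n) x) = inner (defect T x) x" for n x
    by (induction n) (simp_all add: step nrm algebra_simps)
  have "0 \<le> inner (defect T x) x" for x
  proof (rule ccontr)
    assume neg: "\<not> ?thesis"
    then obtain n where "inner x x < real n * (- inner (defect T x) x)"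
      using reals_Archimedean3[of "- inner (defect T x) x"] by auto
    moreover have "0 \<le> inner x x + real n * inner (defect T x) x"
      using iter[of n x] inner_ge_zero[of "(T ^^ n) x"] by simp
    ultimately show False by simp
  qed
  then show ?thesis using bc sym by (simp add: positive_op_iff)
qed

section \<open>Block structure of a quasi-Brownian isometry\<close>

text \<open>
  \<open>S\<close> is the square root of the defect operator and \<open>Q\<close> the projection onto the orthogonal
  complement of its kernel, so that \<open>Q \<circ> T \<circ> Q\<close> is the corner \<open>X\<close> of \<open>T\<close>.
\<close>

locale quasi_brownian =
  fixes T S Q :: "'a::chilbert_space \<Rightarrow> 'a"
  assumes T: "bounded_clinear T" and S: "bounded_clinear S" and Q: "bounded_clinear Q"
    and S_sym: "inner (S x) y = inner x (S y)"
    and Q_sym: "inner (Q x) y = inner x (Q y)"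
    and Q_idem [simp]: "Q (Q x) = Q x"
    and Q_eq_0_iff: "Q x = 0 \<longleftrightarrow> S x = 0"
    and adj_T_T: "adj T (T x) = x + S (S x)"
    and adj_T_S_S_T: "adj T (S (S (T x))) = S (S x)"
    and S_S_T: "S (S (T x)) = S (T (S x))"
begin

sublocale T: bounded_linear T by (rule bounded_clinear_imp_bounded_linear[OF T])
sublocale S: bounded_linear S by (rule bounded_clinear_imp_bounded_linear[OF S])
sublocale Q: bounded_linear Q by (rule bounded_clinear_imp_bounded_linear[OF Q])
sublocale adj_T: bounded_linear "adj T"
  by (rule bounded_clinear_imp_bounded_linear[OF bounded_clinear_adj[OF T]])

lemma inner_T_left: "inner (T x) y = inner x (adj T y)"
  by (rule inner_adj[OF T])

lemma inner_T_right: "inner x (T y) = inner (adj T x) y"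
  using inner_adj[OF T, of y x] by (simp add: inner_commute)

lemma S_Q [simp]: "S (Q x) = S x"
  using Q_eq_0_iff[of "x - Q x"] by (simp add: Q.diff S.diff)

lemma Q_S [simp]: "Q (S x) = S x"
  by (rule inner_extI) (simp add: Q_sym S_sym)

text \<open>Cancelling one \<open>S\<close> in \<open>S_S_T\<close> is possible up to the kernel of
  \<open>Q\<close>. Since \<open>S\<close> absorbs \<open>Q\<close>, this says that \<open>X\<close>
  commutes with \<open>S\<close>.\<close>

lemma Q_T_S [simp]: "Q (T (S x)) = S (T x)"
  using Q_eq_0_iff[of "T (S x) - S (T x)"] by (simp add: Q.diff S.diff S_S_T)

lemma inner_T_T: "inner (T x) (T y) = inner x y + inner (S x) (S y)"
  by (simp add: inner_T_left adj_T_T inner_add_right S_sym)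

lemma inner_S_T: "inner (S (T x)) (S (T y)) = inner (S x) (S y)"
  by (simp add: S_sym inner_T_left adj_T_S_S_T)

text \<open>By \<open>inner_S_T\<close>, \<open>S (T x)\<close> and \<open>S x\<close> have equal
  norms. Invariance of the kernel of \<open>S\<close> is the upper triangular form of
  \<open>T\<close>.\<close>

lemma S_T_eq_0: "S x = 0 \<Longrightarrow> S (T x) = 0"
  using inner_S_T[of x x] by simp

lemma Q_T_Q [simp]: "Q (T (Q x)) = Q (T x)"
  using S_T_eq_0[of "x - Q x"] Q_eq_0_iff[of "T (x - Q x)"] by (simp add: Q.diff S.diff T.diff)

text \<open>The adjoint of \<open>Q_T_S\<close>: the adjoint of \<open>X\<close> commutes with
  \<open>S\<close> as well.\<close>

lemma adj_T_S: "adj T (S x) = S (adj T (Q x))"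
proof (rule inner_extI)
  show "inner (adj T (S x)) y = inner (S (adj T (Q x))) y" for y
    by (simp add: S_sym Q_sym flip: inner_T_right)
qed

text \<open>Such a \<open>z\<close> lies in the kernel of \<open>S\<close>, which is that of
  \<open>Q\<close>. This serves as density of the range of \<open>S\<close> in the range of
  \<open>Q\<close>.\<close>

lemma eq_0_if_orthogonal_range: "Q z = z \<Longrightarrow> (\<And>y. inner z (S y) = 0) \<Longrightarrow> z = 0"
  using Q_eq_0_iff[of z] by (metis S_sym inner_eq_zero_iff)

text \<open>On the range of \<open>S\<close>, \<open>Q_T_S\<close> and \<open>inner_S_T\<close> show
  that \<open>X\<close> preserves inner products. Density extends this to the range of
  \<open>Q\<close>, one argument of the inner product at a time.\<close>

lemma corner_isometry: "Q (adj T (Q (T x))) = Q x"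
proof -
  have *: "Q (adj T (S (T y))) = S y" for y
  proof -
    define z where "z = Q (adj T (S (T y))) - S y"
    have "z = 0"
    proof (rule eq_0_if_orthogonal_range)
      show "Q z = z" by (simp add: z_def Q.diff)
      show "inner z (S w) = 0" for w
      proof -
        have "inner (Q (adj T (S (T y)))) (S w) = inner (S (T y)) (Q (T (S w)))"
          by (simp add: Q_sym flip: inner_T_right) (metis Q_S Q_sym Q_T_S)
        then show ?thesis by (simp add: z_def inner_diff_left inner_S_T)
      qed
    qed
    then show ?thesis by (simp add: z_def)
  qed
  define z where "z = Q (adj T (Q (T x))) - Q x"
  have "z = 0"
  proof (rule eq_0_if_orthogonal_range)
    show "Q z = z" by (simp add: z_def Q.diff)
    show "inner z (S y) = 0" for y
    proof -
      have "inner (Q (adj T (Q (T x)))) (S y) = inner (Q (T (Q x))) (T (S y))"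
        by (simp add: Q_sym flip: inner_T_right)
      also have "\<dots> = inner (T (Q x)) (S (T y))" by (simp add: Q_sym del: Q_T_Q)
      also have "\<dots> = inner (Q x) (Q (adj T (S (T y))))" by (simp add: inner_T_left flip: Q_sym)
      finally show ?thesis by (simp add: z_def inner_diff_left *)
    qed
  qed
  then show ?thesis by (simp add: z_def)
qed

text \<open>The projection onto the orthogonal complement of the range of \<open>X\<close> within the range of \<open>Q\<close>.\<close>

definition N :: "'a \<Rightarrow> 'a" where "N x = Q x - Q (T (adj T (Q x)))"

lemma N: "bounded_clinear N"
  unfolding N_def
  by (rule bounded_clinear_diff[OF Q bounded_clinear_compose[OF Q bounded_clinear_compose[OF T
            bounded_clinear_compose[OF bounded_clinear_adj[OF T] Q]]]])

sublocale N: bounded_linear N by (rule bounded_clinear_imp_bounded_linear[OF N])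

lemma N_sym: "inner (N x) y = inner x (N y)"
proof -
  have *: "inner (Q (T (adj T (Q x)))) y = inner (adj T (Q x)) (adj T (Q y))" for x y
    by (simp add: Q_sym inner_T_left)
  have "inner x (Q (T (adj T (Q y)))) = inner (adj T (Q x)) (adj T (Q y))"
    using *[of y x] by (simp add: inner_commute)
  then show ?thesis by (simp add: N_def inner_diff * Q_sym inner_T_left)
qed

lemma Q_N [simp]: "Q (N x) = N x" and N_Q [simp]: "N (Q x) = N x"
  by (simp_all add: N_def Q.diff)

text \<open>Since \<open>X\<^sup>* X\<close> is the identity on the range of \<open>Q\<close>,
  \<open>X - X X\<^sup>* X = 0\<close>.\<close>

lemma N_T [simp]: "N (T x) = 0"
  using Q_T_Q[of "adj T (Q (T x))"] by (simp add: N_def corner_isometry del: Q_T_Q) simp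

lemma N_idem [simp]: "N (N x) = N x"
  using N_Q[of "T (adj T (Q x))"] by (subst (2) N_def) (simp add: N.diff del: N_Q, simp)

text \<open>\<open>X\<close> and its adjoint both commute with \<open>S\<close>, hence so does
  \<open>N\<close>, which is \<open>Q - X X\<^sup>*\<close>.\<close>

lemma N_S: "N (S x) = S (N x)"
proof -
  have "S (N x) = S x - Q (T (S (adj T (Q x))))" by (simp add: N_def S.diff)
  also have "\<dots> = N (S x)" by (simp add: N_def del: Q_T_S flip: adj_T_S)
  finally show ?thesis by simp
qed

lemma adj_T_N [simp]: "adj T (N x) = 0"
proof -
  have "inner (adj T (N x)) y = inner 0 y" for y by (simp add: N_sym flip: inner_T_right)
  then show ?thesis by (rule inner_extI)
qed

text \<open>By definition of \<open>N\<close>, the \<open>Q\<close>-part of the argument vanishes,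
  and \<open>S\<close> sees only that part. This is the Brownian identity of the extension at place
  \<open>0\<close>.\<close>

lemma S_codefect_S: "S (T (adj T (S x)) + N (S x) - S x) = 0"
  by (simp add: N_def S.diff S.add)

lemma orth_decomp_T: "orth_decomp {x. Q x = 0} {x. Q x = x}"
  by (rule orth_decomp_kernel_fixed[OF Q Q_sym Q_idem])

lemmas orth_proj_Q = orth_proj_fixed[OF Q Q_sym Q_idem] orth_proj_kernel[OF Q Q_sym Q_idem]

lemma brownian_type_I_T:
  assumes "\<not> isometry_on UNIV T"
  shows "brownian_type_I {x. Q x = 0} {x. Q x = x} T"
proof -
  let ?H1 = "{x. Q x = 0}" and ?H2 = "{x. Q x = x}"
  have closed: "closed_csubspace ?H1" "closed_csubspace ?H2"
    using orth_decomp_T by (auto simp: orth_decomp_def)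
  then have sub: "subspace ?H1" "\<And>c x. x \<in> ?H1 \<Longrightarrow> c *\<^sub>C x \<in> ?H1"
    "subspace ?H2" "\<And>c x. x \<in> ?H2 \<Longrightarrow> c *\<^sub>C x \<in> ?H2"
    by (auto simp: closed_csubspace_def)
  have QT0: "Q (T h) = 0" if "Q h = 0" for h
    using that S_T_eq_0 by (simp add: Q_eq_0_iff)
  have V: "block ?H1 ?H1 T h = T h" if "Q h = 0" for h
    using that by (simp add: block_def orth_proj_Q QT0)
  have E: "block ?H1 ?H2 T h = T h - Q (T h)" if "Q h = h" for h
    using that by (simp add: block_def orth_proj_Q)
  have X: "block ?H2 ?H2 T h = Q (T h)" if "Q h = h" for h
    using that by (simp add: block_def orth_proj_Q)
  have inner_X: "inner (Q (T x)) (Q (T y)) = inner x y" if "Q x = x" for x y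
  proof -
    have "inner (Q (T x)) (Q (T y)) = inner x (Q y)"
      using Q_sym[of x "adj T (Q (T y))"] that by (simp add: Q_sym inner_T_left corner_isometry)
    then show ?thesis using Q_sym[of x y] that by simp
  qed
  have "norm (Q (T h)) = norm h" if "Q h = h" for h
    using inner_X[OF that, of h] by (simp add: norm_eq_sqrt_inner)
  note norm_X = this
  have norm_V: "norm (T h) = norm h" if "Q h = 0" for h
    using inner_T_T[of h h] that by (simp add: norm_eq_sqrt_inner Q_eq_0_iff)
  \<comment> \<open>If a summand were zero, \<open>T\<close> would coincide with the other diagonal
    entry, which is isometric.\<close>
  have "?H1 \<noteq> {0}"
  proof
    assume "?H1 = {0}"
    moreover have "x - Q x \<in> ?H1" for x by (simp add: Q.diff)
    ultimately have "Q x = x" for x by (metis eq_iff_diff_eq_0 singletonD)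
    then show False using norm_X assms by (simp add: isometry_on_def)
  qed
  moreover have "?H2 \<noteq> {0}"
  proof
    assume "?H2 = {0}"
    moreover have "Q x \<in> ?H2" for x by simp
    ultimately have "Q x = 0" for x by blast
    then show False using norm_V assms by (simp add: isometry_on_def)
  qed
  moreover have adj_V: "adj_on ?H1 (block ?H1 ?H1 T) (block ?H1 ?H2 T h) = 0" if h: "Q h = h" for h
  proof (rule adj_onI[OF sub(1,2)])
    show "block ?H1 ?H1 T (c *\<^sub>C x) = c *\<^sub>C block ?H1 ?H1 T x" if "x \<in> ?H1" for c x
      using sub(2)[OF that] that by (simp add: V bounded_clinear_scaleC[OF T])
    show "inner (block ?H1 ?H1 T x) (block ?H1 ?H2 T h) = inner x 0" if "x \<in> ?H1" for x
    proof -
      from that have x: "Q x = 0" by simp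
      have "inner (T x) (Q (T h)) = 0" by (simp add: QT0 x flip: Q_sym)
      moreover have "inner x h = 0" using Q_sym[of x h] x h by simp
      moreover have "S x = 0" using x by (simp add: Q_eq_0_iff)
      ultimately show ?thesis using x h by (simp add: V E inner_diff_right inner_T_T)
    qed
  qed (simp_all add: Q.zero)
  \<comment> \<open>\<open>E\<^sup>* E = S\<^sup>2\<close> results from subtracting the isometry
    identity of \<open>X\<close> from \<open>inner_T_T\<close>.\<close>
  moreover have adj_E: "adj_on ?H2 (block ?H1 ?H2 T) (block ?H1 ?H2 T h) = S (S h)"
    if h: "Q h = h" for h
  proof (rule adj_onI[OF sub(3,4)])
    show "block ?H1 ?H2 T (c *\<^sub>C x) = c *\<^sub>C block ?H1 ?H2 T x" if "x \<in> ?H2" for c x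
      using sub(4)[OF that] that
      by (simp add: E bounded_clinear_scaleC[OF T] bounded_clinear_scaleC[OF Q] scaleC_diff)
    show "inner (block ?H1 ?H2 T x) (block ?H1 ?H2 T h) = inner x (S (S h))" if "x \<in> ?H2" for x
    proof -
      from that have x: "Q x = x" by simp
      have "inner (Q (T x)) (T h) = inner x h" "inner (T x) (Q (T h)) = inner x h"
        "inner (Q (T x)) (Q (T h)) = inner x h"
        using inner_X[OF x, of h] by (simp_all add: Q_sym)
      then show ?thesis using x h by (simp add: E inner_diff inner_T_T S_sym)
    qed
  qed (simp_all)
  moreover have "block ?H2 ?H2 T (S (S h)) = S (S (Q (T h)))" if "Q h = h" for h
    by (simp add: X S_S_T)
  moreover have "block ?H2 ?H1 T h = 0" if "Q h = 0" for h
    using that by (simp add: block_def orth_proj_Q QT0)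
  ultimately show ?thesis
    unfolding brownian_type_I_def Let_def isometry_on_def
    using orth_decomp_T T norm_V norm_X by (simp add: V X)
qed

end

section \<open>The extension on square-summable sequences\<close>

text \<open>The index map leads from target places to source places. If it is injective on
  \<open>D\<close>, each source coordinate is used at most once, which gives boundedness.\<close>

definition shift ::
    "nat set \<Rightarrow> (nat \<Rightarrow> nat) \<Rightarrow> ('a::complex_inner \<Rightarrow> 'a) \<Rightarrow> 'a ell2 \<Rightarrow> 'a ell2" where
  "shift D \<sigma> A f = Abs_ell2 (\<lambda>n. if n \<in> D then A (coord f (\<sigma> n)) else 0)"

lemma ell2_eqI: "(\<And>n. coord f n = coord g n) \<Longrightarrow> f = g"
  by (simp add: coord_inject[symmetric] fun_eq_iff)

lemma shift_bound:
  fixes A :: "'a::complex_inner \<Rightarrow> 'a"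
  assumes inj: "inj_on \<sigma> D" and C: "\<And>x. norm (A x) \<le> norm x * C"
  shows shift_summable: "summable (\<lambda>n. (norm (if n \<in> D then A (coord f (\<sigma> n)) else 0))\<^sup>2)"
    and shift_suminf_le:
      "(\<Sum>n. (norm (if n \<in> D then A (coord f (\<sigma> n)) else 0))\<^sup>2) \<le> (norm f * C)\<^sup>2"
proof -
  have bound: "(\<Sum>n<M. (norm (if n \<in> D then A (coord f (\<sigma> n)) else 0))\<^sup>2) \<le> (norm f * C)\<^sup>2" for M
  proof -
    have inj': "inj_on \<sigma> ({..<M} \<inter> D)" using inj by (rule inj_on_subset) simp
    have "(\<Sum>n<M. (norm (if n \<in> D then A (coord f (\<sigma> n)) else 0))\<^sup>2)
        = (\<Sum>n\<in>{..<M} \<inter> D. (norm (A (coord f (\<sigma> n))))\<^sup>2)"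
      by (rule sum.mono_neutral_cong_right) auto
    also have "\<dots> \<le> (\<Sum>n\<in>{..<M} \<inter> D. (norm (coord f (\<sigma> n)) * C)\<^sup>2)"
      by (intro sum_mono power_mono C) simp
    also have "\<dots> = (\<Sum>m\<in>\<sigma> ` ({..<M} \<inter> D). (norm (coord f m))\<^sup>2) * C\<^sup>2"
      by (simp add: sum.reindex[OF inj'] power_mult_distrib sum_distrib_right)
    also have "\<dots> \<le> (norm f)\<^sup>2 * C\<^sup>2"
      unfolding norm_ell2_sq by (intro mult_right_mono sum_le_suminf summable_coord) auto
    finally show ?thesis by (simp add: power_mult_distrib)
  qed
  show summ: "summable (\<lambda>n. (norm (if n \<in> D then A (coord f (\<sigma> n)) else 0))\<^sup>2)"
    by (rule summableI_nonneg_bounded[OF _ bound]) simp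
  show "(\<Sum>n. (norm (if n \<in> D then A (coord f (\<sigma> n)) else 0))\<^sup>2) \<le> (norm f * C)\<^sup>2"
    by (rule suminf_le_const[OF summ bound])
qed

lemma coord_shift:
  assumes "inj_on \<sigma> D" "bounded_clinear A"
  shows "coord (shift D \<sigma> A f) n = (if n \<in> D then A (coord f (\<sigma> n)) else 0)"
proof -
  obtain C where "\<And>x. norm (A x) \<le> norm x * C"
    using bounded_linear.bounded[OF bounded_clinear_imp_bounded_linear[OF assms(2)]] by blast
  from shift_summable[OF assms(1) this] show ?thesis
    unfolding shift_def by (subst Abs_ell2_inverse) simp_all
qed

lemma bounded_clinear_shift:
  assumes "inj_on \<sigma> D" "bounded_clinear A"
  shows "bounded_clinear (shift D \<sigma> A)"
proof -
  note bl = bounded_clinear_imp_bounded_linear[OF assms(2)]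
  note c = coord_shift[OF assms]
  obtain C where C: "C > 0" "\<And>x. norm (A x) \<le> norm x * C"
    using bounded_linear.pos_bounded[OF bl] by blast
  have scC: "shift D \<sigma> A (a *\<^sub>C f) = a *\<^sub>C shift D \<sigma> A f" for a f
    by (rule ell2_eqI) (simp add: c scaleC_ell2.rep_eq bounded_clinear_scaleC[OF assms(2)])
  have "norm (shift D \<sigma> A f) \<le> norm f * C" for f
  proof -
    have "(norm (shift D \<sigma> A f))\<^sup>2 \<le> (norm f * C)\<^sup>2"
      unfolding norm_ell2_sq[of "shift D \<sigma> A f"] c by (rule shift_suminf_le[OF assms(1) C(2)])
    then show ?thesis by (rule power2_le_imp_le) (simp add: C(1) less_imp_le)
  qed
  moreover have "shift D \<sigma> A (f + g) = shift D \<sigma> A f + shift D \<sigma> A g" for f g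
    by (rule ell2_eqI) (simp add: c plus_ell2.rep_eq linear_simps[OF bl])
  ultimately have "bounded_linear (shift D \<sigma> A)"
    by (intro bounded_linear_intro[where K = C]) (simp_all add: scC flip: scaleC_of_real)
  then show ?thesis using scC by (simp add: bounded_clinear_def)
qed

text \<open>The unordered form of the sum allows reindexing along a bijection, as the adjoint of a
  shift requires.\<close>

lemma has_sum_inner_ell2:
  "((\<lambda>n. inner (coord f n) (coord g n)) has_sum inner f g) UNIV"
proof -
  have "(\<lambda>n. inner (coord f n) (coord g n)) sums inner f g"
    using sums_Re[OF summable_sums[OF summable_cinner[of f g]]]
    by (simp add: inner_eq_Re_cinner cinner_ell2_def)
  moreover have "summable (\<lambda>n. norm (inner (coord f n) (coord g n)))"
  proof (rule summable_comparison_test'[where N = 0])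
    show "summable (\<lambda>n. (norm (coord f n))\<^sup>2 + (norm (coord g n))\<^sup>2)"
      by (intro summable_add summable_coord)
    show "norm (norm (inner (coord f n) (coord g n)))
        \<le> (norm (coord f n))\<^sup>2 + (norm (coord g n))\<^sup>2" for n
    proof -
      have "norm (inner (coord f n) (coord g n)) \<le> norm (coord f n) * norm (coord g n)"
        by (simp add: Cauchy_Schwarz_ineq2)
      moreover have "2 * (norm (coord f n) * norm (coord g n))
          \<le> (norm (coord f n))\<^sup>2 + (norm (coord g n))\<^sup>2"
        using sum_squares_bound[of "norm (coord f n)" "norm (coord g n)"] by simp
      moreover have "0 \<le> norm (coord f n) * norm (coord g n)" by simp
      ultimately show ?thesis by simp
    qed
  qed
  ultimately show ?thesis
    by (metis norm_summable_imp_has_sum)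
qed

lemma inner_shift:
  assumes A: "bounded_clinear A" "bounded_clinear B" "\<And>x y. inner (A x) y = inner x (B y)"
    and st: "\<And>n. n \<in> D \<Longrightarrow> \<sigma> n \<in> D' \<and> \<tau> (\<sigma> n) = n" "\<And>m. m \<in> D' \<Longrightarrow> \<tau> m \<in> D \<and> \<sigma> (\<tau> m) = m"
  shows "inner (shift D \<sigma> A f) g = inner f (shift D' \<tau> B g)"
proof -
  have inj: "inj_on \<sigma> D" "inj_on \<tau> D'" using st by (metis inj_onI)+
  have bij: "bij_betw \<sigma> D D'" using st by (intro bij_betwI[where g = \<tau>]) auto
  have "((\<lambda>n. inner (coord (shift D \<sigma> A f) n) (coord g n)) has_sum inner (shift D \<sigma> A f) g) UNIV"
    by (rule has_sum_inner_ell2)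
  then have "((\<lambda>n. inner (coord f (\<sigma> n)) (B (coord g (\<tau> (\<sigma> n)))))
      has_sum inner (shift D \<sigma> A f) g) D"
    by (rule has_sum_cong_neutral[THEN iffD1, rotated -1])
      (use st in \<open>auto simp: coord_shift[OF inj(1) A(1)] A(3)\<close>)
  then have "((\<lambda>m. inner (coord f m) (B (coord g (\<tau> m)))) has_sum inner (shift D \<sigma> A f) g) D'"
    by (subst (asm) has_sum_reindex_bij_betw[OF bij])
  moreover have "((\<lambda>m. inner (coord f m) (coord (shift D' \<tau> B g) m))
      has_sum inner f (shift D' \<tau> B g)) UNIV"
    by (rule has_sum_inner_ell2)
  then have "((\<lambda>m. inner (coord f m) (B (coord g (\<tau> m)))) has_sum inner f (shift D' \<tau> B g)) D'"
    by (rule has_sum_cong_neutral[THEN iffD1, rotated -1])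
      (auto simp: coord_shift[OF inj(2) A(2)])
  ultimately show ?thesis by (rule has_sum_unique)
qed

definition at0 :: "'a::complex_inner \<Rightarrow> 'a ell2" where
  "at0 h = Abs_ell2 (\<lambda>n. if n = 0 then h else 0)"

lemma coord_at0: "coord (at0 h) n = (if n = 0 then h else 0)"
proof -
  have "summable (\<lambda>n::nat. (norm (if n = 0 then h else 0))\<^sup>2)"
    by (rule summable_finite[of "{0}"]) auto
  then show ?thesis unfolding at0_def by (subst Abs_ell2_inverse) simp_all
qed

lemma norm_at0: "norm (at0 h) = norm h"
proof -
  have "(\<Sum>n. (norm (coord (at0 h) n))\<^sup>2) = (\<Sum>n\<in>{0}. (norm (coord (at0 h) n))\<^sup>2)"
    by (rule suminf_finite) (auto simp: coord_at0)
  then have "(norm (at0 h))\<^sup>2 = (norm h)\<^sup>2" by (simp add: norm_ell2_sq coord_at0)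
  then show ?thesis by (simp add: power2_eq_iff_nonneg)
qed

lemma at0_zero: "at0 0 = 0"
  and at0_add: "at0 (x + y) = at0 x + at0 y"
  and at0_diff: "at0 (x - y) = at0 x - at0 y"
  and at0_scaleC: "at0 (c *\<^sub>C x) = c *\<^sub>C at0 x"
  by (rule ell2_eqI;
      simp add: coord_at0 zero_ell2.rep_eq plus_ell2.rep_eq minus_ell2.rep_eq scaleC_ell2.rep_eq)+

section \<open>The Brownian extension and its defect\<close>

context quasi_brownian
begin

lemma bounded_clinear_N_S: "bounded_clinear (\<lambda>x. N (S x))"
  by (rule bounded_clinear_compose[OF N S])

lemma bounded_clinear_N': "bounded_clinear (\<lambda>x. x - N x)"
  by (rule bounded_clinear_diff[OF bounded_clinear_id N])

text \<open>
  The second space of the extension consists of the sequences \<open>f\<close> with \<open>f 0\<close> in the range of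
  \<open>Q\<close>, \<open>f n\<close> in the range of \<open>N\<close> for odd \<open>n\<close> and \<open>f n = 0\<close> for even \<open>n > 0\<close>. The first two
  summands contain the unitary extension of \<open>X\<close>, which feeds the odd places back into place
  \<open>0\<close>; the third one extends the corner \<open>E\<close> by copies of \<open>S\<close>. The last two move the rest of the
  first space to the places divisible by \<open>4\<close>, out of the way of the range of the third.
\<close>

definition R :: "'a ell2 \<Rightarrow> 'a ell2" where
  "R f = shift {0} (\<lambda>n. n) T f + shift {n. n = 0 \<or> odd n} (\<lambda>n. if n = 0 then 1 else n + 2) N f +
     shift {n. n mod 4 = 2} (\<lambda>n. n div 2) (\<lambda>x. N (S x)) f +
     shift {n. 4 dvd n \<and> odd (n div 4)} (\<lambda>n. n div 4) (\<lambda>x. x - N x) f +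
     shift {n. 4 dvd n \<and> 0 < n \<and> even (n div 4)} (\<lambda>n. n div 4) (\<lambda>x. x) f"

text \<open>The adjoint of \<open>R\<close>, summand by summand, with inverted index maps. Truncated
  subtraction matters: \<open>1 - 2 = 0\<close> inverts the step from \<open>0\<close> to
  \<open>1\<close>.\<close>

definition R' :: "'a ell2 \<Rightarrow> 'a ell2" where
  "R' g = shift {0} (\<lambda>n. n) (adj T) g + shift {m. odd m} (\<lambda>m. m - 2) N g +
     shift {m. odd m} (\<lambda>m. 2 * m) (\<lambda>x. N (S x)) g +
     shift {m. odd m} (\<lambda>m. 4 * m) (\<lambda>x. x - N x) g +
     shift {m. even m \<and> 0 < m} (\<lambda>m. 4 * m) (\<lambda>x. x) g"

text \<open>The projection onto the second space of the extension; its kernel is the first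
  space.\<close>

definition K :: "'a ell2 \<Rightarrow> 'a ell2" where
  "K f = shift {0} (\<lambda>n. n) Q f + shift {n. odd n} (\<lambda>n. n) N f"

lemma inj_R:
  "inj_on (\<lambda>n::nat. n) D"
  "inj_on (\<lambda>n::nat. if n = 0 then 1 else n + 2) {n. n = 0 \<or> odd n}"
  "inj_on (\<lambda>n::nat. n div 2) {n. n mod 4 = 2}"
  "inj_on (\<lambda>n::nat. n div 4) {n. 4 dvd n \<and> odd (n div 4)}"
  "inj_on (\<lambda>n::nat. n div 4) {n. 4 dvd n \<and> 0 < n \<and> even (n div 4)}"
  "inj_on (\<lambda>m::nat. m - 2) {m. odd m}"
  "inj_on (\<lambda>m::nat. 2 * m) D"
  "inj_on (\<lambda>m::nat. 4 * m) D"
proof -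
  show "inj_on (\<lambda>n::nat. if n = 0 then 1 else n + 2) {n. n = 0 \<or> odd n}"
    by (rule inj_on_inverseI[where g = "\<lambda>m. m - 2"]) auto
  show "inj_on (\<lambda>n::nat. n div 2) {n. n mod 4 = 2}"
    by (rule inj_on_inverseI[where g = "\<lambda>m. 2 * m"]) (simp, presburger)
  show "inj_on (\<lambda>m::nat. m - 2) {m. odd m}"
    by (rule inj_on_inverseI[where g = "\<lambda>n. if n = 0 then 1 else n + 2"]) (auto elim!: oddE)
  show "inj_on (\<lambda>n::nat. n div 4) {n. 4 dvd n \<and> odd (n div 4)}"
    "inj_on (\<lambda>n::nat. n div 4) {n. 4 dvd n \<and> 0 < n \<and> even (n div 4)}"
    by (rule inj_on_inverseI[where g = "\<lambda>m. 4 * m"]; simp)+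
qed (simp_all add: inj_on_def)

lemma bounded_clinear_R: "bounded_clinear R"
  unfolding R_def
  by (intro bounded_clinear_add bounded_clinear_shift inj_R T N bounded_clinear_N_S
      bounded_clinear_N' bounded_clinear_id)

lemma inner_R: "inner (R f) g = inner f (R' g)"
proof -
  have NS: "inner (N (S x)) y = inner x (N (S y))" for x y
    by (simp add: N_sym S_sym N_S)
  have N': "inner (x - N x) y = inner x (y - N y)" for x y
    by (simp add: inner_diff N_sym)
  have "inner (shift {0} (\<lambda>n. n) T f) g = inner f (shift {0} (\<lambda>n. n) (adj T) g)"
    by (rule inner_shift[OF T bounded_clinear_adj[OF T] inner_T_left]) auto
  moreover have "inner (shift {n. n = 0 \<or> odd n} (\<lambda>n. if n = 0 then 1 else n + 2) N f) g
      = inner f (shift {m. odd m} (\<lambda>m. m - 2) N g)"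
    by (rule inner_shift[OF N N N_sym]) (auto elim!: oddE)
  moreover have "inner (shift {n. n mod 4 = 2} (\<lambda>n. n div 2) (\<lambda>x. N (S x)) f) g
      = inner f (shift {m. odd m} (\<lambda>m. 2 * m) (\<lambda>x. N (S x)) g)"
    by (rule inner_shift[OF bounded_clinear_N_S bounded_clinear_N_S NS])
      (simp_all, presburger+)
  moreover have "inner (shift {n. 4 dvd n \<and> odd (n div 4)} (\<lambda>n. n div 4) (\<lambda>x. x - N x) f) g
      = inner f (shift {m. odd m} (\<lambda>m. 4 * m) (\<lambda>x. x - N x) g)"
    by (rule inner_shift[OF bounded_clinear_N' bounded_clinear_N' N']) auto
  moreover have "inner (shift {n. 4 dvd n \<and> 0 < n \<and> even (n div 4)} (\<lambda>n. n div 4) (\<lambda>x. x) f) g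
      = inner f (shift {m. even m \<and> 0 < m} (\<lambda>m. 4 * m) (\<lambda>x. x) g)"
    by (rule inner_shift[OF bounded_clinear_id bounded_clinear_id refl]) auto
  ultimately show ?thesis by (simp add: R_def R'_def inner_add)
qed

lemma adj_R: "adj R g = R' g"
  by (rule adjI[OF bounded_clinear_R inner_R])

lemmas coord_shifts =
  coord_shift[OF inj_R(1) T] coord_shift[OF inj_R(1) bounded_clinear_adj[OF T]]
  coord_shift[OF inj_R(1) Q] coord_shift[OF inj_R(1) N] coord_shift[OF inj_R(2) N]
  coord_shift[OF inj_R(3) bounded_clinear_N_S] coord_shift[OF inj_R(4) bounded_clinear_N']
  coord_shift[OF inj_R(5) bounded_clinear_id] coord_shift[OF inj_R(6) N]
  coord_shift[OF inj_R(7) bounded_clinear_N_S] coord_shift[OF inj_R(8) bounded_clinear_N']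
  coord_shift[OF inj_R(8) bounded_clinear_id]

text \<open>Every place is \<open>0\<close>, odd, twice an odd number, or a positive multiple of
  \<open>4\<close>; the indices are written as \<open>R'\<close> reads them.\<close>

lemma coord_R:
  "coord (R f) 0 = T (coord f 0) + N (coord f 1)"
  "odd n \<Longrightarrow> coord (R f) n = N (coord f (n + 2))"
  "odd n \<Longrightarrow> coord (R f) (2 * n) = N (S (coord f n))"
  "odd n \<Longrightarrow> coord (R f) (4 * n) = coord f n - N (coord f n)"
  "even n \<Longrightarrow> n \<noteq> 0 \<Longrightarrow> coord (R f) (4 * n) = coord f n"
proof -
  show "coord (R f) 0 = T (coord f 0) + N (coord f 1)"
    by (simp add: R_def plus_ell2.rep_eq coord_shifts)
  {
    assume n: "odd n"
    then have "n \<noteq> 0" "n mod 4 \<noteq> 2" "\<not> 4 dvd n" by presburger+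
    with n show "coord (R f) n = N (coord f (n + 2))"
      by (simp add: R_def plus_ell2.rep_eq coord_shifts)
    from n have "2 * n \<noteq> 0" "(2 * n) mod 4 = 2" "\<not> 4 dvd 2 * n" by presburger+
    then show "coord (R f) (2 * n) = N (S (coord f n))"
      by (simp add: R_def plus_ell2.rep_eq coord_shifts)
    from n show "coord (R f) (4 * n) = coord f n - N (coord f n)"
      by (auto simp: R_def plus_ell2.rep_eq coord_shifts)
  }
  assume "even n" "n \<noteq> 0"
  then show "coord (R f) (4 * n) = coord f n"
    by (simp add: R_def plus_ell2.rep_eq coord_shifts)
qed

lemma coord_R':
  "coord (R' g) 0 = adj T (coord g 0)"
  "odd m \<Longrightarrow> coord (R' g) m = N (coord g (m - 2)) + N (S (coord g (2 * m))) +
     (coord g (4 * m) - N (coord g (4 * m)))"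
  "even m \<Longrightarrow> m \<noteq> 0 \<Longrightarrow> coord (R' g) m = coord g (4 * m)"
  by (auto simp: R'_def plus_ell2.rep_eq coord_shifts)

lemma defect_R: "defect R f = R' (R f) - f"
  by (simp add: defect_def adj_R)

text \<open>The defect is the square of the diagonal extension of \<open>S\<close>. At odd places
  the parts \<open>N\<close>, \<open>N S\<close> and \<open>1 - N\<close> of \<open>R\<close>
  contribute \<open>N\<close>, \<open>S\<^sup>2 N\<close> and \<open>1 - N\<close>; at place
  \<open>0\<close> the cross term vanishes by \<open>adj_T_N\<close>.\<close>

lemma coord_defect_R:
  "coord (defect R f) 0 = S (S (coord f 0))"
  "odd m \<Longrightarrow> coord (defect R f) m = S (S (N (coord f m)))"
  "even m \<Longrightarrow> m \<noteq> 0 \<Longrightarrow> coord (defect R f) m = 0"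
proof -
  show "coord (defect R f) 0 = S (S (coord f 0))"
    by (simp add: defect_R minus_ell2.rep_eq coord_R coord_R' adj_T.add adj_T_T)
  show "coord (defect R f) m = 0" if "even m" "m \<noteq> 0"
    using that by (simp add: defect_R minus_ell2.rep_eq coord_R coord_R')
  show "coord (defect R f) m = S (S (N (coord f m)))" if m: "odd m"
  proof -
    \<comment> \<open>For \<open>m = 1\<close> the coordinate is read at place \<open>0\<close>,
      where \<open>N_T\<close> removes the contribution of \<open>T\<close>.\<close>
    have "N (coord (R f) (m - 2)) = N (coord f m)"
    proof (cases "m = 1")
      case True then show ?thesis by (simp add: coord_R N.add)
    next
      case False
      with m have "odd (m - 2)" "m - 2 + 2 = m" by presburger+
      then show ?thesis using coord_R(2)[of "m - 2" f] by simp
    qed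
    then show ?thesis
      using m by (simp add: defect_R minus_ell2.rep_eq coord_R coord_R' N.diff N_S S.diff)
  qed
qed

lemma nat_odd_even_cases:
  obtains "n = 0" | "odd n" | "even n" "n \<noteq> (0::nat)"
  by blast

text \<open>The defect vanishes at positive even places, so at odd places only the unitary extension
  of \<open>X\<close> contributes, and it commutes with the extended \<open>S\<close>. Place
  \<open>0\<close> reduces to \<open>adj_T_S_S_T\<close>.\<close>

lemma adj_defect_R: "R' (defect R (R f)) = defect R f"
proof (rule ell2_eqI)
  fix m :: nat
  show "coord (R' (defect R (R f))) m = coord (defect R f) m"
  proof (cases m rule: nat_odd_even_cases)
    case 1
    have "adj T (S (S (N x))) = 0" for x by (simp flip: N_S)
    then show ?thesis
      by (simp add: 1 coord_R' coord_defect_R coord_R T.add S.add adj_T.add adj_T_S_S_T)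
  next
    case 2
    have "N (coord (defect R (R f)) (m - 2)) = S (S (N (coord f m)))"
    proof (cases "m = 1")
      case True then show ?thesis by (simp add: coord_defect_R coord_R S.add N.add N_S)
    next
      case False
      with 2 have "odd (m - 2)" "m - 2 + 2 = m" by presburger+
      then show ?thesis
        using coord_R(2)[of "m - 2" f] coord_defect_R(2)[of "m - 2" "R f"] by (simp add: N_S)
    qed
    then show ?thesis
      using 2 odd_pos[OF 2] by (simp add: coord_R' coord_defect_R S.zero N.zero)
  next
    case 3
    then show ?thesis by (simp add: coord_R' coord_defect_R)
  qed
qed

lemma two_isometry_R: "two_isometry R"
proof -
  interpret R': bounded_linear R'
    using bounded_clinear_imp_bounded_linear[OF bounded_clinear_adj[OF bounded_clinear_R]]
    by (simp add: adj_R[abs_def])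
  have "R' (R' (R (R f))) - 2 *\<^sub>R R' (R f) + f = 0" for f
    using adj_defect_R[of f] by (simp add: defect_R R'.diff scaleR_2 algebra_simps)
  then show ?thesis using bounded_clinear_R by (simp add: two_isometry_def adj_R)
qed

text \<open>On the range of the defect, the codefect vanishes at odd places because the extension of
  \<open>X\<close> is unitary; at place \<open>0\<close> its value is killed by
  \<open>S\<close>.\<close>

lemma brownian_isometry_R: "brownian_isometry R"
proof -
  have "defect R (codefect R (defect R f)) = 0" for f
  proof (rule ell2_eqI)
    fix m :: nat
    \<comment> \<open>The terms of \<open>R'\<close> read at \<open>2 * n\<close> and
      \<open>4 * n\<close> drop out, since the defect vanishes there.\<close>
    have odd: "coord (R' (defect R f)) n = N (coord (defect R f) (n - 2))" if "odd n" for n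
      using that odd_pos[OF that] by (simp add: coord_R' coord_defect_R S.zero N.zero)
    show "coord (defect R (codefect R (defect R f))) m = coord 0 m"
    proof (cases m rule: nat_odd_even_cases)
      case 1
      have "coord (codefect R (defect R f)) 0 =
          T (adj T (S (S (coord f 0)))) + N (S (S (coord f 0))) - S (S (coord f 0))"
        by (simp add: codefect_def adj_R minus_ell2.rep_eq coord_R coord_R'(1) odd coord_defect_R)
      then show ?thesis
        using S_codefect_S[of "S (coord f 0)"]
        by (simp add: 1 coord_defect_R(1) zero_ell2.rep_eq S.zero)
    next
      case 2
      then show ?thesis
        by (simp add: codefect_def adj_R minus_ell2.rep_eq coord_R odd coord_defect_R(2) N_S
            N.diff S.zero zero_ell2.rep_eq)
    next
      case 3
      then show ?thesis by (simp add: coord_defect_R zero_ell2.rep_eq)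
    qed
  qed
  then show ?thesis using two_isometry_R by (simp add: brownian_isometry_def)
qed

section \<open>Decomposition of the sequence space and the embedding\<close>

lemma coord_K:
  "coord (K f) n = (if n = 0 then Q (coord f 0) else if odd n then N (coord f n) else 0)"
  by (simp add: K_def plus_ell2.rep_eq coord_shifts)

lemma K: "bounded_clinear K"
  unfolding K_def by (intro bounded_clinear_add bounded_clinear_shift inj_R Q N)

lemma K_sym: "inner (K f) g = inner f (K g)"
proof -
  have "inner (shift {0} (\<lambda>n. n) Q f) g = inner f (shift {0} (\<lambda>n. n) Q g)"
    by (rule inner_shift[OF Q Q Q_sym]) auto
  moreover have "inner (shift {n. odd n} (\<lambda>n. n) N f) g = inner f (shift {n. odd n} (\<lambda>n. n) N g)"
    by (rule inner_shift[OF N N N_sym]) auto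
  ultimately show ?thesis by (simp add: K_def inner_add)
qed

lemma K_idem: "K (K f) = K f"
  by (rule ell2_eqI) (simp add: coord_K)

lemma K_at0: "K (at0 h) = at0 (Q h)"
  by (rule ell2_eqI) (simp add: coord_K coord_at0 N.zero)

lemma R_at0: "R (at0 h) = at0 (T h)"
proof (rule ell2_eqI)
  show "coord (R (at0 h)) n = coord (at0 (T h)) n" for n
    by (auto simp: R_def plus_ell2.rep_eq coord_shifts coord_at0 N.zero S.zero)
qed

text \<open>\<open>at0\<close> intertwines \<open>Q\<close> with \<open>K\<close> and
  \<open>T\<close> with \<open>R\<close>, hence all four blocks; it serves as both
  embeddings.\<close>

lemma entrywise_extension_R:
  "entrywise_extension {x. Q x = 0} {x. Q x = x} T {f. K f = 0} {f. K f = f} R"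
  unfolding entrywise_extension_def isometric_embedding_def isometry_on_def
  by (rule exI[of _ at0], rule exI[of _ at0])
    (auto simp: K_at0 R_at0 at0_zero at0_add at0_diff at0_scaleC norm_at0 block_def orth_proj_Q
      orth_proj_fixed[OF K K_sym K_idem] orth_proj_kernel[OF K K_sym K_idem])

end

theorem corollary1p6:
  fixes T :: "'a::chilbert_space \<Rightarrow> 'a"
  assumes "quasi_brownian_isometry T"
  shows "\<exists>H\<^sub>1 H\<^sub>2 (K\<^sub>1 :: 'a ell2 set) K\<^sub>2 R.
           orth_decomp H\<^sub>1 H\<^sub>2 \<and> (\<not> isometry_on UNIV T \<longrightarrow> brownian_type_I H\<^sub>1 H\<^sub>2 T) \<and>
           orth_decomp K\<^sub>1 K\<^sub>2 \<and> brownian_isometry R \<and>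
           entrywise_extension H\<^sub>1 H\<^sub>2 T K\<^sub>1 K\<^sub>2 R"
proof -
  define S where "S = op_sqrt (defect T)"
  have T: "two_isometry T" and quasi: "defect T (T x) = S (T (S x))" for x
    using assms by (auto simp: quasi_brownian_isometry_def S_def fun_eq_iff)
  note pos = positive_defect[OF T]
  have S: "bounded_clinear S" "\<And>x y. inner (S x) y = inner x (S y)"
    using positive_op_sqrt[OF pos] by (auto simp: positive_op_iff S_def)
  have SS: "S (S x) = defect T x" for x
    by (simp add: S_def op_sqrt_square[OF pos])
  \<comment> \<open>\<open>P\<close> projects onto the kernel of \<open>S\<close>, so its complement
    is the \<open>Q\<close> of the locale.\<close>
  obtain P where P: "bounded_clinear P" "\<And>x y. inner (P x) y = inner x (P y)"
    "\<And>x. P (P x) = P x" "\<And>x. P x = x \<longleftrightarrow> S x = 0"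
    using orthogonal_projection_exists[OF closed_csubspace_kernel[OF S(1)]] by auto
  interpret P: bounded_linear P by (rule bounded_clinear_imp_bounded_linear[OF P(1)])
  interpret quasi_brownian T S "\<lambda>x. x - P x"
  proof
    show "bounded_clinear T" by (rule two_isometryD(1)[OF T])
    show "bounded_clinear S" by (rule S)
    show "bounded_clinear (\<lambda>x. x - P x)"
      by (rule bounded_clinear_diff[OF bounded_clinear_id P(1)])
    show "adj T (S (S (T x))) = S (S x)" for x by (simp add: SS adj_defect[OF T])
    show "adj T (T x) = x + S (S x)" for x by (simp add: SS defect_def)
    show "x - P x = 0 \<longleftrightarrow> S x = 0" for x using P(4)[of x] by auto
  qed (simp_all add: S P SS quasi inner_diff P.diff)
  show ?thesis
    using orth_decomp_T brownian_type_I_T orth_decomp_kernel_fixed[OF K K_sym K_idem]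
      brownian_isometry_R entrywise_extension_R by blast
qed

end
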